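(* Let $W$ be a finite Coxeter group of rank $n$, let $\mathcal{A}$ be its arrangement of root hyperplanes, and let $x\ne0$ be real. Then the measure $H_{W,x}$ arises from the card-shuffling walk on the chambers of $\mathcal{A}$ with face weights $v_x(F)=\frac{\chi(L^{z(F)},x)}{x^n|z^{-1}(z(F))|}$: for every $w\in W$, the transition weight of this walk from the chamber of the identity to the chamber of $w$ (the sum of $v_x(F)$ over all faces $F$ which move the identity chamber to the chamber of $w$) equals $H_{W,x}(w)$.
   Context: General definition (for any real arrangement). Let $\mathcal{A}=\{H_i\}_{i\in I}$ be a finite hyperplane arrangement in a real vector space $V$ of dimension $n$. Chambers are the components of the complement; faces are the nonempty sets $\bigcap_{i}H_i^{\epsilon_i}$, $\epsilon_i\in\{0,+,-\}$, with $H_i^0=H_i$ and $H_i^\pm$ the two open half-spaces. $L$ is the set of nonempty intersections of hyperplanes (including $V$), ordered by reverse inclusion, with Möbius function $\mu$; for $X\in L$, $L^X=\{Y\in L:Y\ge X\}$ and $\chi(L^X,x)=\sum_{Y\ge X}\mu(X,Y)x^{\dim Y}$. The map $z$ sends a face $F$ to its support $z(F)\in L$, the intersection of $V$ with all hyperplanes containing $F$. A face $F$ moves a chamber $C$ to the unique chamber whose closure contains $F$ and which among such chambers is separated from $C$ by the fewest hyperplanes. The card-shuffling walk of $\mathcal{A}$ with parameter $x\neq0$ is the (possibly signed) chain on chambers whose transition weight from $C$ to $C'$ is the sum of $v_x(F)=\frac{\chi(L^{z(F)},x)}{x^n|z^{-1}(z(F))|}$ over faces $F$ moving $C$ to $C'$;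 by Zaslavsky's theorem $|z^{-1}(Y)|=(-1)^{\dim Y}\chi(L^Y,-1)$. Coxeter case. $W$ acts on its $n$-dimensional real reflection representation $V$ with base $\Pi$ of simple roots; $\mathcal{A}$ is the set of root hyperplanes. The chamber of $w$ is $wC$ with $C=\{v:\langle v,\alpha\rangle>0\ \forall\alpha\in\Pi\}$. $Des(w)$ is the set of $\alpha\in\Pi$ with $w(\alpha)$ negative. For $K\subseteq\Pi$, $W_K$ is the parabolic subgroup generated by reflections in the roots of $K$, $Fix(W_K)$ its fixed space, $N_W(W_K)$ its normalizer in $W$, and $\lambda(K)$ the set of subsets $J\subseteq\Pi$ with $w(K)=J$ for some $w\in W$. By definition $$H_{W,x}(w)=\sum_{K\subseteq\Pi-Des(w)}\frac{|W_K|\chi(L^{Fix(W_K)},x)}{x^n|N_W(W_K)||\lambda(K)|}.$$ *)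

theory Defs
  imports "HOL-Analysis.Analysis" "HOL-Algebra.Group_Action" "HOL-Algebra.Generated_Groups"
begin

section \<open>Hyperplane arrangements\<close>

text \<open>
  The ambient space is a type of class \<^class>\<open>real_inner\<close>; it is finite-dimensional as soon as a
  finite set spans it, which the root systems below guarantee. The class \<^class>\<open>euclidean_space\<close>
  would exclude dimension 0. An arrangement is a finite set of (possibly affine) hyperplanes
  \<open>{v. a \<bullet> v = b}\<close> with \<open>a \<noteq> 0\<close>.
\<close>

text \<open>
  The pairs \<open>(a, b)\<close> and \<open>(- a, - b)\<close> describe the same hyperplane, so a hyperplane has exactly two
  open half-spaces in the sense of the following definition.
\<close>

definition open_half_spaces :: "'a::real_inner set \<Rightarrow> 'a set set" where
  "open_half_spaces H = {S. \<exists>a b. a \<noteq> 0 \<and> H = {v. a \<bullet> v = b} \<and> S = {v. a \<bullet> v < b}}"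

definition chambers :: "'a::real_inner set set \<Rightarrow> 'a set set" where
  "chambers A = components (- \<Union>A)"

definition faces :: "'a::real_inner set set \<Rightarrow> 'a set set" where
  "faces A = {F. F \<noteq> {} \<and>
     (\<exists>\<epsilon>. (\<forall>H\<in>A. \<epsilon> H = H \<or> \<epsilon> H \<in> open_half_spaces H) \<and> F = (\<Inter>H\<in>A. \<epsilon> H))}"

definition separating :: "'a::real_inner set set \<Rightarrow> 'a set \<Rightarrow> 'a set \<Rightarrow> 'a set set" where
  "separating A C D =
     {H\<in>A. \<exists>S\<in>open_half_spaces H. \<exists>T\<in>open_half_spaces H. S \<noteq> T \<and> C \<subseteq> S \<and> D \<subseteq> T}"

text \<open>The strict inequality expresses that the minimizing chamber is the only one.\<close>

definition moves :: "'a::real_inner set set \<Rightarrow> 'a set \<Rightarrow> 'a set \<Rightarrow> 'a set \<Rightarrow> bool" where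
  "moves A F C C' \<longleftrightarrow>
     C' \<in> chambers A \<and> F \<subseteq> closure C' \<and>
     (\<forall>D\<in>chambers A. F \<subseteq> closure D \<and> D \<noteq> C' \<longrightarrow>
        card (separating A C C') < card (separating A C D))"

subsection \<open>The intersection poset\<close>

text \<open>
  \<open>intersection_poset A\<close> contains the whole space, as the intersection of the empty subfamily.
  Its order is reverse inclusion: \<open>X \<le> Y\<close> in the poset means \<open>Y \<subseteq> X\<close>.
\<close>

definition intersection_poset :: "'a set set \<Rightarrow> 'a set set" where
  "intersection_poset A = {\<Inter>B | B. B \<subseteq> A \<and> \<Inter>B \<noteq> {}}"

definition supp_flat :: "'a set set \<Rightarrow> 'a set \<Rightarrow> 'a set" where
  "supp_flat A F = \<Inter>{H\<in>A. F \<subseteq> H}"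

text \<open>
  The Moebius function of a finite family \<open>L\<close> of sets ordered by reverse inclusion:
  \<open>\<mu>(X, X) = 1\<close> and \<open>\<mu>(X, Y) = - (\<Sum>X \<le> Z < Y. \<mu>(X, Z))\<close> for \<open>X < Y\<close>.
\<close>

function moebius :: "'a set set \<Rightarrow> 'a set \<Rightarrow> 'a set \<Rightarrow> int" where
  "moebius L X Y =
     (if infinite L \<or> \<not> Y \<subseteq> X then 0
      else if X = Y then 1
      else - (\<Sum>Z | Z \<in> L \<and> Z \<subseteq> X \<and> Y \<subset> Z. moebius L X Z))"
  by pat_completeness auto
termination
proof (relation "Wellfounded.measure (\<lambda>(L, X, Y). card {Z\<in>L. Y \<subset> Z})")
  fix L :: "'a set set" and X Y Z :: "'a set"
  assume "\<not> (infinite L \<or> \<not> Y \<subseteq> X)" and Z: "Z \<in> {Z. Z \<in> L \<and> Z \<subseteq> X \<and> Y \<subset> Z}"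
  then have "finite {Z\<in>L. Y \<subset> Z}" and "{W\<in>L. Z \<subset> W} \<subset> {W\<in>L. Y \<subset> W}"
    by auto
  then show "((L, X, Z), (L, X, Y)) \<in> Wellfounded.measure (\<lambda>(L, X, Y). card {Z\<in>L. Y \<subset> Z})"
    by (simp add: psubset_card_mono)
qed simp

declare moebius.simps [simp del]

lemma sum_moebius:
  assumes "finite L" "X \<in> L" "Y \<in> L" "Y \<subseteq> X"
  shows "(\<Sum>Z | Z \<in> L \<and> Z \<subseteq> X \<and> Y \<subseteq> Z. moebius L X Z) = (if X = Y then 1 else 0)"
proof -
  have "{Z. Z \<in> L \<and> Z \<subseteq> X \<and> Y \<subseteq> Z} = insert Y {Z. Z \<in> L \<and> Z \<subseteq> X \<and> Y \<subset> Z}"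
    using assms by auto
  moreover have "finite {Z. Z \<in> L \<and> Z \<subseteq> X \<and> Y \<subset> Z}"
    using assms by simp
  ultimately have "(\<Sum>Z | Z \<in> L \<and> Z \<subseteq> X \<and> Y \<subseteq> Z. moebius L X Z) =
      moebius L X Y + (\<Sum>Z | Z \<in> L \<and> Z \<subseteq> X \<and> Y \<subset> Z. moebius L X Z)"
    by simp
  moreover have "{Z. Z \<in> L \<and> Z \<subseteq> X \<and> Y \<subset> Z} = {}" if "X = Y"
    using that by auto
  ultimately show ?thesis
    using assms moebius.simps[of L X Y] by (auto simp del: Collect_empty_eq)
qed

text \<open>The dimension of a flat is that of its space of directions, as a flat may miss the origin.\<close>

definition flat_dim :: "'a::real_vector set \<Rightarrow> nat" where
  "flat_dim Y = dim {u - v | u v. u \<in> Y \<and> v \<in> Y}"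

text \<open>\<open>flat_char_poly A X x\<close> is \<open>\<chi>(L\<^sup>X, x)\<close>, where \<open>L\<close> is the intersection poset of \<open>A\<close>.\<close>

definition flat_char_poly :: "'a::real_inner set set \<Rightarrow> 'a set \<Rightarrow> real \<Rightarrow> real" where
  "flat_char_poly A X x =
     (\<Sum>Y | Y \<in> intersection_poset A \<and> Y \<subseteq> X.
        of_int (moebius (intersection_poset A) X Y) * x ^ flat_dim Y)"

subsection \<open>The card-shuffling walk\<close>

definition face_weight :: "'a::real_inner set set \<Rightarrow> real \<Rightarrow> 'a set \<Rightarrow> real" where
  "face_weight A x F =
     flat_char_poly A (supp_flat A F) x /
     (x ^ dim (UNIV :: 'a set) * real (card {G\<in>faces A. supp_flat A G = supp_flat A F}))"

definition transition_weight ::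
    "'a::real_inner set set \<Rightarrow> real \<Rightarrow> 'a set \<Rightarrow> 'a set \<Rightarrow> real" where
  "transition_weight A x C C' = (\<Sum>F | F \<in> faces A \<and> moves A F C C'. face_weight A x F)"

section \<open>Finite Coxeter groups\<close>

text \<open>
  A finite Coxeter group is given as the group generated by the reflections in the roots of a
  finite reduced root system (not necessarily crystallographic) spanning the space, which is then
  its reflection representation. The base of simple roots is \<open>\<Delta>\<close>, the usual capital Pi being binder syntax.
  A root is positive if its negative is a negative root.
\<close>

definition reflection :: "'a::real_inner \<Rightarrow> 'a \<Rightarrow> 'a" where
  "reflection \<alpha> v = v - (2 * (v \<bullet> \<alpha>) / (\<alpha> \<bullet> \<alpha>)) *\<^sub>R \<alpha>"

definition root_system :: "'a::real_inner set \<Rightarrow> bool" where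
  "root_system \<Phi> \<longleftrightarrow>
     finite \<Phi> \<and> 0 \<notin> \<Phi> \<and> span \<Phi> = UNIV \<and>
     (\<forall>\<alpha>\<in>\<Phi>. \<Phi> \<inter> span {\<alpha>} = {\<alpha>, - \<alpha>}) \<and>
     (\<forall>\<alpha>\<in>\<Phi>. reflection \<alpha> ` \<Phi> = \<Phi>)"

definition negative_root :: "'a::real_inner set \<Rightarrow> 'a set \<Rightarrow> 'a \<Rightarrow> bool" where
  "negative_root \<Phi> \<Delta> \<beta> \<longleftrightarrow>
     \<beta> \<in> \<Phi> \<and> (\<exists>c. (\<forall>\<alpha>\<in>\<Delta>. c \<alpha> \<le> 0) \<and> \<beta> = (\<Sum>\<alpha>\<in>\<Delta>. c \<alpha> *\<^sub>R \<alpha>))"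

definition simple_system :: "'a::real_inner set \<Rightarrow> 'a set \<Rightarrow> bool" where
  "simple_system \<Phi> \<Delta> \<longleftrightarrow>
     \<Delta> \<subseteq> \<Phi> \<and> independent \<Delta> \<and>
     (\<forall>\<beta>\<in>\<Phi>. negative_root \<Phi> \<Delta> \<beta> \<or> negative_root \<Phi> \<Delta> (- \<beta>))"

definition reflection_group :: "'a::real_inner set \<Rightarrow> ('a \<Rightarrow> 'a) monoid" where
  "reflection_group R = subgroup_generated (BijGroup UNIV) (reflection ` R)"

definition root_arrangement :: "'a::real_inner set \<Rightarrow> 'a set set" where
  "root_arrangement \<Phi> = (\<lambda>\<alpha>. {v. \<alpha> \<bullet> v = 0}) ` \<Phi>"

definition chamber_of :: "'a::real_inner set \<Rightarrow> ('a \<Rightarrow> 'a) \<Rightarrow> 'a set" where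
  "chamber_of \<Delta> w = w ` {v. \<forall>\<alpha>\<in>\<Delta>. v \<bullet> \<alpha> > 0}"

definition Des :: "'a::real_inner set \<Rightarrow> 'a set \<Rightarrow> ('a \<Rightarrow> 'a) \<Rightarrow> 'a set" where
  "Des \<Phi> \<Delta> w = {\<alpha>\<in>\<Delta>. negative_root \<Phi> \<Delta> (w \<alpha>)}"

definition fixed_space :: "('a \<Rightarrow> 'a) set \<Rightarrow> 'a set" where
  "fixed_space U = {v. \<forall>w\<in>U. w v = v}"

definition conj_subsets :: "'a::real_inner set \<Rightarrow> 'a set \<Rightarrow> 'a set \<Rightarrow> 'a set set" where
  "conj_subsets \<Phi> \<Delta> K = {J. J \<subseteq> \<Delta> \<and> (\<exists>w\<in>carrier (reflection_group \<Phi>). w ` K = J)}"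

text \<open>
  \<open>coxeter_H \<Phi> \<Delta> x w\<close> is \<open>H\<^sub>W\<^sub>,\<^sub>x(w)\<close>; the parabolic subgroup \<open>W\<^sub>K\<close> is \<open>reflection_group K\<close>
  and \<open>\<lambda>(K)\<close> is \<open>conj_subsets \<Phi> \<Delta> K\<close>.
\<close>

definition coxeter_H :: "'a::real_inner set \<Rightarrow> 'a set \<Rightarrow> real \<Rightarrow> ('a \<Rightarrow> 'a) \<Rightarrow> real" where
  "coxeter_H \<Phi> \<Delta> x w =
     (\<Sum>K\<in>Pow (\<Delta> - Des \<Phi> \<Delta> w).
        (let W = reflection_group \<Phi>; W\<^sub>K = carrier (reflection_group K) in
          (real (card W\<^sub>K) * flat_char_poly (root_arrangement \<Phi>) (fixed_space W\<^sub>K) x) /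
          (x ^ card \<Delta> * real (card (normalizer W W\<^sub>K)) * real (card (conj_subsets \<Phi> \<Delta> K)))))"

end

theory Submission
  imports Defs
begin

text \<open>
  Every face is \<open>u F\<^sub>J\<close> with \<open>u \<in> W\<close> and \<open>F\<^sub>J\<close> the face of the fundamental chamber on which exactly
  the simple roots in \<open>J\<close> vanish. A face moves a chamber to the one that lies on the required side
  of the hyperplanes missing the face and on the side of the given chamber for the other
  hyperplanes. For the chamber of \<open>w\<close> this says that the face is \<open>w F\<^sub>K\<close> with \<open>w\<close> positive on \<open>K\<close>,
  that is, \<open>K \<inter> Des w = {}\<close>. The support of \<open>w F\<^sub>K\<close> is \<open>w Fix(W\<^sub>K)\<close>. Since \<open>W\<^sub>J\<close> is the stabilizer of
  \<open>F\<^sub>J\<close>, and \<open>Fix(W\<^sub>J)\<close> can be moved to \<open>Fix(W\<^sub>K)\<close> exactly if \<open>J \<in> \<lambda>(K)\<close>, and then by \<open>|N(W\<^sub>K)|\<close>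
  elements, there are \<open>|\<lambda>(K)| |N(W\<^sub>K)| / |W\<^sub>K|\<close> faces with this support.
\<close>

section \<open>Reflections and the groups they generate\<close>

text \<open>Cells are named by points, so faces, closures, supports and separation become statements
  about signs of inner products with roots. Positivity of roots is read off from one vector \<rho>:
  the coordinates of a root in \<Delta> have one sign, so their sum cannot vanish. Uniqueness
  statements about faces go back to the exchange condition: a vector of the closed fundamental
  chamber is the only one there in its orbit, and the simple reflections fixing it generate its
  stabilizer. The obstacle is \<lambda>(K). It speaks of simple roots, whereas a support only
  remembers a flat, and an element u with u Fix(W_J) = Fix(W_K) may carry J to roots that are not
  simple. Multiplying u by an element of W_K does not change the image of the flat, and it can be
  chosen so that the roots in J stay positive and those in K come from positive roots. Then simple
  roots go to simple roots. The faces with one support may have several types J, so they need not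
  form a single orbit; pairs are counted, and all stabilizers have the same order.\<close>

abbreviation inverse_map :: "('a \<Rightarrow> 'b) \<Rightarrow> 'b \<Rightarrow> 'a" where
  "inverse_map \<equiv> inv_into UNIV"

lemma inner_reflection_left: "reflection \<alpha> u \<bullet> v = u \<bullet> reflection \<alpha> v"
  by (simp add: reflection_def inner_diff_left inner_diff_right inner_commute)

lemma reflection_uminus: "reflection (- \<alpha>) = reflection \<alpha>"
  by (simp add: reflection_def fun_eq_iff)

lemma reflection_reflection [simp]: "reflection \<alpha> (reflection \<alpha> v) = v"
proof (cases "\<alpha> = 0")
  case False
  then have "reflection \<alpha> v \<bullet> \<alpha> = - (v \<bullet> \<alpha>)"
    by (simp add: reflection_def inner_diff_left)
  then show ?thesis
    by (simp add: reflection_def[of \<alpha> "reflection \<alpha> v"]) (simp add: reflection_def)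
qed (simp add: reflection_def)

lemma inner_reflection [simp]: "reflection \<alpha> u \<bullet> reflection \<alpha> v = u \<bullet> v"
  by (simp add: inner_reflection_left)

lemma linear_reflection: "linear (reflection \<alpha>)"
  by (rule linearI)
    (simp_all add: reflection_def inner_add_left add_divide_distrib distrib_left scaleR_add_left algebra_simps)

lemma reflection_fix_iff: "\<alpha> \<noteq> 0 \<Longrightarrow> reflection \<alpha> v = v \<longleftrightarrow> \<alpha> \<bullet> v = 0"
  by (auto simp: reflection_def inner_commute)

lemma reflection_self: "\<alpha> \<noteq> 0 \<Longrightarrow> reflection \<alpha> \<alpha> = - \<alpha>"
  by (simp add: reflection_def scaleR_2)

lemma bij_reflection: "bij (reflection \<alpha>)"
  by (rule o_bij[of "reflection \<alpha>"]) (simp_all add: fun_eq_iff)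

section \<open>Words of reflections\<close>

primrec word :: "'a::real_inner list \<Rightarrow> 'a \<Rightarrow> 'a" where
  "word [] = id"
| "word (a # l) = reflection a \<circ> word l"

lemma word_append: "word (l @ m) = word l \<circ> word m"
  by (induction l) auto

lemma word_rev: "word (rev l) (word l v) = v" "word l (word (rev l) v) = v"
  by (induction l arbitrary: v) (auto simp: word_append)

lemma linear_word: "linear (word l)"
proof (induction l)
  case (Cons a l)
  then show ?case by (simp only: word.simps linear_compose linear_reflection)
qed (simp add: linear_id[unfolded id_def] id_def)

lemma inner_word: "word l u \<bullet> word l v = u \<bullet> v"
  by (induction l) auto

lemma bij_word: "bij (word l)"
  by (rule o_bij[of "word (rev l)"]) (auto simp: fun_eq_iff word_rev)

lemma Bij_UNIV: "Bij UNIV = {f. bij f}"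
  by (auto simp: Bij_def extensional_def)

lemma carrier_BijGroup_UNIV: "carrier (BijGroup UNIV) = {f. bij f}"
  by (simp add: BijGroup_def Bij_UNIV)

lemma mult_BijGroup_UNIV: "bij f \<Longrightarrow> bij g \<Longrightarrow> f \<otimes>\<^bsub>BijGroup UNIV\<^esub> g = f \<circ> g"
  by (simp add: BijGroup_def Bij_UNIV compose_def fun_eq_iff)

lemma one_BijGroup_UNIV: "\<one>\<^bsub>BijGroup UNIV\<^esub> = id"
  by (simp add: BijGroup_def fun_eq_iff)

lemma inv_BijGroup_UNIV: "bij f \<Longrightarrow> m_inv (BijGroup UNIV) f = inverse_map f"
  by (subst inv_BijGroup) (auto simp: Bij_UNIV)

lemma inverse_map_reflection: "inverse_map (reflection a) = reflection a"
  by (rule inv_unique_comp) (auto simp: fun_eq_iff)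

text \<open>Reflections are involutions, so inverses of generators are again letters and words
  without inverses exhaust the generated group. From here on the group is handled by induction over
  lists, and lengths become available for the exchange condition.\<close>

lemma carrier_reflection_group: "carrier (reflection_group R) = {word l | l. set l \<subseteq> R}"
proof -
  let ?G = "BijGroup (UNIV :: 'a set)"
  \<comment> \<open>\<open>subgroup_generated\<close> keeps only generators inside the ambient
    carrier. Every reflection is a bijection, even the one in 0, which is the identity.\<close>
  have S: "carrier ?G \<inter> reflection ` R = reflection ` R"
    by (auto simp: carrier_BijGroup_UNIV bij_reflection)
  have "w \<in> {word l | l. set l \<subseteq> R}" if "w \<in> generate ?G (reflection ` R)" for w
    using that
  proof (induction rule: generate.induct)
    case one
    then show ?case by (auto simp: one_BijGroup_UNIV intro!: exI[of _ "[]"])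
  next
    case (incl h)
    then obtain a where "a \<in> R" "h = word [a]" by auto
    then show ?case by (intro CollectI exI[of _ "[a]"]) auto
  next
    case (inv h)
    then obtain a where "a \<in> R" "h = reflection a" by auto
    then show ?case
      by (intro CollectI exI[of _ "[a]"])
        (auto simp: inv_BijGroup_UNIV bij_reflection inverse_map_reflection)
  next
    case (eng h1 h2)
    then obtain l1 l2 where "h1 = word l1" "set l1 \<subseteq> R" "h2 = word l2" "set l2 \<subseteq> R" by auto
    then show ?case
      by (intro CollectI exI[of _ "l1 @ l2"]) (auto simp: mult_BijGroup_UNIV bij_word word_append)
  qed
  moreover have "word l \<in> generate ?G (reflection ` R)" if "set l \<subseteq> R" for l
    using that
  proof (induction l)
    case Nil
    then show ?case by (metis generate.one one_BijGroup_UNIV word.simps(1))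
  next
    case (Cons a l)
    then have "reflection a \<otimes>\<^bsub>?G\<^esub> word l \<in> generate ?G (reflection ` R)"
      by (intro generate.eng[OF generate.incl]) auto
    then show ?case by (simp only: mult_BijGroup_UNIV bij_reflection bij_word word.simps)
  qed
  ultimately show ?thesis
    unfolding reflection_group_def carrier_subgroup_generated S by blast
qed

lemma reflection_group_id: "id \<in> carrier (reflection_group R)"
  unfolding carrier_reflection_group by (intro CollectI exI[of _ "[]"]) auto

lemma reflection_group_reflection: "a \<in> R \<Longrightarrow> reflection a \<in> carrier (reflection_group R)"
  unfolding carrier_reflection_group by (intro CollectI exI[of _ "[a]"]) auto

lemma reflection_group_comp:
  assumes "u \<in> carrier (reflection_group R)" "v \<in> carrier (reflection_group R)"
  shows "u \<circ> v \<in> carrier (reflection_group R)"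
proof -
  obtain l m where "u = word l" "v = word m" "set l \<subseteq> R" "set m \<subseteq> R"
    using assms by (auto simp: carrier_reflection_group)
  then show ?thesis
    unfolding carrier_reflection_group by (intro CollectI exI[of _ "l @ m"]) (auto simp: word_append)
qed

lemma reflection_group_bij: "w \<in> carrier (reflection_group R) \<Longrightarrow> bij w"
  by (auto simp: carrier_reflection_group bij_word)

lemma reflection_group_linear: "w \<in> carrier (reflection_group R) \<Longrightarrow> linear w"
  by (auto simp: carrier_reflection_group linear_word)

lemma reflection_group_inner: "w \<in> carrier (reflection_group R) \<Longrightarrow> w u \<bullet> w v = u \<bullet> v"
  by (auto simp: carrier_reflection_group inner_word)

lemma reflection_group_inv_left:
  "w \<in> carrier (reflection_group R) \<Longrightarrow> inverse_map w (w v) = v"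
  by (meson reflection_group_bij bij_is_inj inv_f_f)

lemma reflection_group_inv_right:
  "w \<in> carrier (reflection_group R) \<Longrightarrow> w (inverse_map w v) = v"
  by (meson reflection_group_bij bij_is_surj surj_f_inv_f)

lemma reflection_group_inv:
  assumes "w \<in> carrier (reflection_group R)"
  shows "inverse_map w \<in> carrier (reflection_group R)"
proof -
  obtain l where l: "w = word l" "set l \<subseteq> R"
    using assms by (auto simp: carrier_reflection_group)
  then have "inverse_map w = word (rev l)"
    by (intro inv_unique_comp) (auto simp: fun_eq_iff word_rev)
  with l show ?thesis
    by (auto simp: carrier_reflection_group intro!: exI[of _ "rev l"])
qed

lemma reflection_group_inner_swap:
  "w \<in> carrier (reflection_group R) \<Longrightarrow> w u \<bullet> v = u \<bullet> inverse_map w v"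
  by (metis reflection_group_inner reflection_group_inv_right)

lemma reflection_group_inner_swap':
  "w \<in> carrier (reflection_group R) \<Longrightarrow> u \<bullet> w v = inverse_map w u \<bullet> v"
  by (metis reflection_group_inner reflection_group_inv_right)

lemma reflection_group_mono:
  "R \<subseteq> S \<Longrightarrow> carrier (reflection_group R) \<subseteq> carrier (reflection_group S)"
  by (auto simp: carrier_reflection_group)

lemma conjugate_reflection:
  assumes "w \<in> carrier (reflection_group R)"
  shows "reflection (w a) \<circ> w = w \<circ> reflection a"
proof
  fix v
  show "(reflection (w a) \<circ> w) v = (w \<circ> reflection a) v"
    using assms reflection_group_linear[OF assms]
    by (simp add: reflection_def reflection_group_inner linear_diff linear_scale)
qed

text \<open>Conjugating by the isometry w replaces each letter a of a word by w a.\<close>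

lemma conjugate_reflection_group:
  assumes w: "w \<in> carrier (reflection_group R)"
  shows "carrier (reflection_group (w ` K)) = (\<lambda>u. w \<circ> u \<circ> inverse_map w) ` carrier (reflection_group K)"
proof -
  have *: "word (map w l) \<circ> w = w \<circ> word l" for l
  proof (induction l)
    case (Cons a l)
    have "word (map w (a # l)) \<circ> w = reflection (w a) \<circ> (word (map w l) \<circ> w)" by (simp add: o_assoc)
    also have "\<dots> = (reflection (w a) \<circ> w) \<circ> word l" by (simp only: Cons o_assoc)
    also have "\<dots> = w \<circ> word (a # l)" by (simp only: conjugate_reflection[OF w] o_assoc word.simps)
    finally show ?case .
  qed simp
  have "word (map w l) = w \<circ> word l \<circ> inverse_map w" for l
    using fun_cong[OF *] w by (auto simp: fun_eq_iff) (metis reflection_group_inv_right)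
  then have "{word (map w l) | l. set l \<subseteq> K} = (\<lambda>u. w \<circ> u \<circ> inverse_map w) ` {word l | l. set l \<subseteq> K}"
    by auto
  moreover have "{word (map w l) | l. set l \<subseteq> K} = {word l | l. set l \<subseteq> w ` K}" (is "?L = ?R")
  proof
    show "?L \<subseteq> ?R" by force
    show "?R \<subseteq> ?L"
    proof clarify
      fix l assume "set l \<subseteq> w ` K"
      then obtain m where "l = map w m" "set m \<subseteq> K"
        by (metis lists_eq_set lists_image imageE mem_Collect_eq)
      then show "\<exists>l'. word l = word (map w l') \<and> set l' \<subseteq> K" by auto
    qed
  qed
  ultimately show ?thesis by (simp add: carrier_reflection_group)
qed

lemma card_conjugate_reflection_group:
  assumes w: "w \<in> carrier (reflection_group R)"
  shows "card (carrier (reflection_group (w ` K))) = card (carrier (reflection_group K))"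
  unfolding conjugate_reflection_group[OF w]
proof (rule card_image, rule inj_onI)
  fix u v assume "w \<circ> u \<circ> inverse_map w = w \<circ> v \<circ> inverse_map w"
  then have "w (u (inverse_map w (w y))) = w (v (inverse_map w (w y)))" for y
    by (metis comp_apply)
  then show "u = v"
    using w by (metis ext reflection_group_inv_left)
qed

lemma fixed_space_reflection_group:
  assumes "0 \<notin> K"
  shows "fixed_space (carrier (reflection_group K)) = {v. \<forall>\<alpha>\<in>K. \<alpha> \<bullet> v = 0}"
proof -
  have "word l v = v" if "\<forall>\<alpha>\<in>K. \<alpha> \<bullet> v = 0" "set l \<subseteq> K" for l v
    using that
  proof (induction l)
    case (Cons a l)
    then show ?case using assms by (metis comp_apply list.set_intros(1,2) reflection_fix_iff subset_iff word.simps(2))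
  qed simp
  moreover have "\<alpha> \<bullet> v = 0" if "\<forall>w\<in>carrier (reflection_group K). w v = v" "\<alpha> \<in> K" for v \<alpha>
    using that assms reflection_group_reflection reflection_fix_iff by metis
  ultimately show ?thesis
    by (auto simp: fixed_space_def carrier_reflection_group)
qed

text \<open>Translates the abstract normalizer, a stabilizer under conjugation expressed by cosets,
  into conjugation of maps.\<close>

lemma reflection_group_normalizer:
  assumes "K \<subseteq> R"
  shows "normalizer (reflection_group R) (carrier (reflection_group K)) =
    {g \<in> carrier (reflection_group R).
       (\<lambda>u. g \<circ> u \<circ> inverse_map g) ` carrier (reflection_group K) = carrier (reflection_group K)}"
proof -
  let ?W = "reflection_group R" and ?K = "carrier (reflection_group K)"
  have K: "?K \<subseteq> carrier ?W" by (rule reflection_group_mono[OF assms])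
  have mult: "u \<otimes>\<^bsub>?W\<^esub> v = u \<circ> v" if "u \<in> carrier ?W" "v \<in> carrier ?W" for u v
    using that mult_BijGroup_UNIV[of u v]
    by (simp add: reflection_group_bij) (simp add: reflection_group_def)
  have "group ?W"
    unfolding reflection_group_def by (rule group.group_subgroup_generated[OF group_BijGroup])
  moreover have "inverse_map g \<otimes>\<^bsub>?W\<^esub> g = \<one>\<^bsub>?W\<^esub>" if "g \<in> carrier ?W" for g
  proof -
    have "\<one>\<^bsub>?W\<^esub> = id" by (simp add: reflection_group_def one_BijGroup_UNIV)
    with that show ?thesis
      by (auto simp: mult reflection_group_inv reflection_group_inv_left fun_eq_iff)
  qed
  ultimately have inv: "m_inv ?W g = inverse_map g" if "g \<in> carrier ?W" for g
    using that reflection_group_inv[OF that] by (simp add: group.inv_equality)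
  have "g <#\<^bsub>?W\<^esub> ?K #>\<^bsub>?W\<^esub> m_inv ?W g = (\<lambda>u. g \<circ> u \<circ> inverse_map g) ` ?K" if "g \<in> carrier ?W" for g
    using that K by (auto simp: l_coset_def r_coset_def mult inv reflection_group_comp reflection_group_inv subset_iff image_iff)
  then show ?thesis
    using K by (auto simp: normalizer_def stabilizer_def)
qed

section \<open>Simple roots and dominant vectors\<close>

text \<open>One Gram-Schmidt step per vector: the part q of b orthogonal to the span of B is
  nonzero, and adding a multiple of q corrects the value at b without disturbing the values on
  B.\<close>

lemma dual_vector_exists:
  fixes B :: "'a::real_inner set"
  assumes "finite B" "independent B"
  shows "\<exists>v\<in>span B. \<forall>b\<in>B. v \<bullet> b = g b"
  using assms
proof (induction arbitrary: g rule: finite_induct)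
  case (insert b B)
  then have B: "independent B" "b \<notin> span B"
    by (auto simp: independent_insert)
  obtain v where v: "v \<in> span B" "\<forall>c\<in>B. v \<bullet> c = g c"
    using insert.IH[OF B(1)] by blast
  \<comment> \<open>For the values b \<bullet> c the induction hypothesis returns the orthogonal
    projection of b to the span of B.\<close>
  obtain p where p: "p \<in> span B" "\<forall>c\<in>B. p \<bullet> c = b \<bullet> c"
    using insert.IH[OF B(1), of "\<lambda>c. b \<bullet> c"] by blast
  define q where "q = b - p"
  have orth: "q \<bullet> c = 0" if "c \<in> span B" for c
    using that
    by (induction rule: span_induct_alt) (use p in \<open>auto simp: q_def inner_add_right inner_diff_left\<close>)
  have "q \<noteq> 0" using B p by (auto simp: q_def)
  have "q \<bullet> b = q \<bullet> q + q \<bullet> p" by (simp add: q_def inner_diff_right)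
  then have qb: "q \<bullet> b \<noteq> 0" using orth[OF p(1)] \<open>q \<noteq> 0\<close> by simp
  let ?u = "v + ((g b - v \<bullet> b) / (q \<bullet> b)) *\<^sub>R q"
  have "?u \<in> span (insert b B)"
    using v(1) p(1) span_mono[of B "insert b B"] span_base[of b "insert b B"] unfolding q_def
    by (auto intro!: span_add span_scale span_diff)
  moreover have "?u \<bullet> c = g c" if "c \<in> insert b B" for c
    using that v(2) orth[OF span_base] qb by (auto simp: inner_add_left)
  ultimately show ?case by blast
qed auto

section \<open>Coordinates with respect to the simple roots, and signs of roots\<close>

locale simple_roots =
  fixes \<Phi> \<Delta> :: "'a::real_inner set"
  assumes roots: "root_system \<Phi>" and simple: "simple_system \<Phi> \<Delta>"
begin

abbreviation "W \<equiv> carrier (reflection_group \<Phi>)"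

lemma finite_roots: "finite \<Phi>" and zero_notin_roots: "0 \<notin> \<Phi>"
  and root_multiple: "\<alpha> \<in> \<Phi> \<Longrightarrow> \<beta> \<in> \<Phi> \<Longrightarrow> \<beta> \<in> span {\<alpha>} \<Longrightarrow> \<beta> = \<alpha> \<or> \<beta> = - \<alpha>"
  and uminus_root: "\<alpha> \<in> \<Phi> \<Longrightarrow> - \<alpha> \<in> \<Phi>"
  and reflection_root: "\<alpha> \<in> \<Phi> \<Longrightarrow> \<beta> \<in> \<Phi> \<Longrightarrow> reflection \<alpha> \<beta> \<in> \<Phi>"
  using roots unfolding root_system_def by blast+

lemma simple_subset: "\<Delta> \<subseteq> \<Phi>" and independent_simple: "independent \<Delta>"
  using simple unfolding simple_system_def by blast+

lemma finite_simple: "finite \<Delta>"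
  using finite_subset[OF simple_subset finite_roots] .

lemma span_simple: "span \<Delta> = UNIV"
proof -
  have "\<beta> \<in> span \<Delta>" if "\<beta> \<in> \<Phi>" for \<beta>
  proof -
    have "negative_root \<Phi> \<Delta> \<beta> \<or> negative_root \<Phi> \<Delta> (- \<beta>)"
      using simple that unfolding simple_system_def by blast
    then have "\<beta> \<in> span \<Delta> \<or> - \<beta> \<in> span \<Delta>"
      by (auto simp: negative_root_def) (metis (no_types, lifting) span_base span_scale span_sum)+
    then show ?thesis by (metis span_neg minus_minus)
  qed
  then have "span \<Phi> \<subseteq> span \<Delta>" by (meson span_minimal subsetI subspace_span)
  then show ?thesis using roots unfolding root_system_def by auto
qed

text \<open>The basis dual to \<Delta>, that is, the fundamental weights up to scaling. Pairing with
  it extracts coordinates in \<Delta>.\<close>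

definition weight :: "'a \<Rightarrow> 'a" where
  "weight \<gamma> = (SOME v. \<forall>\<alpha>\<in>\<Delta>. v \<bullet> \<alpha> = (if \<alpha> = \<gamma> then 1 else 0))"

lemma weight_inner: "\<alpha> \<in> \<Delta> \<Longrightarrow> weight \<gamma> \<bullet> \<alpha> = (if \<alpha> = \<gamma> then 1 else 0)"
  using someI_ex[of "\<lambda>v. \<forall>\<alpha>\<in>\<Delta>. v \<bullet> \<alpha> = (if \<alpha> = \<gamma> then 1 else 0)"]
    dual_vector_exists[OF finite_simple independent_simple, of "\<lambda>\<alpha>. if \<alpha> = \<gamma> then 1 else 0"]
  unfolding weight_def by blast

text \<open>A point of the closed fundamental chamber lying on exactly the walls of K when K
  \<subseteq> \<Delta>; the other simple roots take the value 1 there. For K = {} it is interior,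
  and pairing with it gives the height, the sum of the simple coordinates.\<close>

definition face_point :: "'a set \<Rightarrow> 'a" where
  "face_point K = (\<Sum>\<gamma>\<in>\<Delta> - K. weight \<gamma>)"

abbreviation "\<rho> \<equiv> face_point {}"

lemma face_point_inner: "\<alpha> \<in> \<Delta> \<Longrightarrow> face_point K \<bullet> \<alpha> = (if \<alpha> \<in> K then 0 else 1)"
  using finite_simple by (auto simp: face_point_def inner_sum_left weight_inner)

lemma simple_expansion: "v = (\<Sum>\<gamma>\<in>\<Delta>. (v \<bullet> weight \<gamma>) *\<^sub>R \<gamma>)"
proof -
  have "v \<in> span \<Delta>" by (simp add: span_simple)
  then show ?thesis
  proof (induction rule: span_induct_alt)
    case (step c \<alpha> y)
    have "(\<Sum>\<gamma>\<in>\<Delta>. (\<alpha> \<bullet> weight \<gamma>) *\<^sub>R \<gamma>) = (\<Sum>\<gamma>\<in>\<Delta>. if \<gamma> = \<alpha> then \<gamma> else 0)"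
      using step by (intro sum.cong) (auto simp: inner_commute[of \<alpha>] weight_inner)
    also have "\<dots> = \<alpha>" using step finite_simple by simp
    finally show ?case
      using step(2) by (simp add: inner_add_left scaleR_add_left sum.distrib flip: scaleR_scaleR scaleR_sum_right)
  qed simp
qed

lemma inner_expansion: "v \<bullet> u = (\<Sum>\<gamma>\<in>\<Delta>. (v \<bullet> weight \<gamma>) * (\<gamma> \<bullet> u))"
  by (subst simple_expansion[of v]) (simp add: inner_sum_left)

lemma sum_simple_inner_weight: "\<gamma> \<in> \<Delta> \<Longrightarrow> (\<Sum>\<alpha>\<in>\<Delta>. c \<alpha> *\<^sub>R \<alpha>) \<bullet> weight \<gamma> = c \<gamma>"
  using finite_simple
  by (simp add: inner_commute[of _ "weight \<gamma>"] inner_sum_right weight_inner if_distrib[of "(*) _"] cong: if_cong)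

lemma inner_rho: "v \<bullet> \<rho> = (\<Sum>\<gamma>\<in>\<Delta>. v \<bullet> weight \<gamma>)"
  by (simp add: face_point_def inner_sum_right)

lemma negative_root_weight: "negative_root \<Phi> \<Delta> \<beta> \<longleftrightarrow> \<beta> \<in> \<Phi> \<and> (\<forall>\<gamma>\<in>\<Delta>. \<beta> \<bullet> weight \<gamma> \<le> 0)"
  using simple_expansion[of \<beta>] by (auto simp: negative_root_def sum_simple_inner_weight)

lemma root_sign:
  assumes "\<beta> \<in> \<Phi>"
  shows "(\<forall>\<gamma>\<in>\<Delta>. \<beta> \<bullet> weight \<gamma> \<ge> 0) \<or> (\<forall>\<gamma>\<in>\<Delta>. \<beta> \<bullet> weight \<gamma> \<le> 0)"
  using assms simple by (auto simp: simple_system_def negative_root_weight)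

text \<open>Numbers of one sign add up to 0 only if all of them are 0, and a root is not 0.\<close>

lemma root_inner_rho: "\<beta> \<in> \<Phi> \<Longrightarrow> \<beta> \<bullet> \<rho> \<noteq> 0"
proof
  assume \<beta>: "\<beta> \<in> \<Phi>" and "\<beta> \<bullet> \<rho> = 0"
  then have *: "(\<Sum>\<gamma>\<in>\<Delta>. \<beta> \<bullet> weight \<gamma>) = 0" "(\<Sum>\<gamma>\<in>\<Delta>. - (\<beta> \<bullet> weight \<gamma>)) = 0"
    by (simp_all add: inner_rho sum_negf)
  from root_sign[OF \<beta>] have "\<forall>\<gamma>\<in>\<Delta>. \<beta> \<bullet> weight \<gamma> = 0"
  proof
    assume "\<forall>\<gamma>\<in>\<Delta>. \<beta> \<bullet> weight \<gamma> \<ge> 0"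
    then show ?thesis
      using *(1) sum_nonneg_eq_0_iff[OF finite_simple, of "\<lambda>\<gamma>. \<beta> \<bullet> weight \<gamma>"] by simp
  next
    assume "\<forall>\<gamma>\<in>\<Delta>. \<beta> \<bullet> weight \<gamma> \<le> 0"
    then show ?thesis
      using *(2) sum_nonneg_eq_0_iff[OF finite_simple, of "\<lambda>\<gamma>. - (\<beta> \<bullet> weight \<gamma>)"] by simp
  qed
  then have "\<beta> = 0" using simple_expansion[of \<beta>] by simp
  with \<beta> zero_notin_roots show False by simp
qed

lemma positive_root_weight: "\<beta> \<in> \<Phi> \<Longrightarrow> \<beta> \<bullet> \<rho> > 0 \<Longrightarrow> \<gamma> \<in> \<Delta> \<Longrightarrow> \<beta> \<bullet> weight \<gamma> \<ge> 0"
  using root_sign[of \<beta>] sum_nonpos[of \<Delta> "\<lambda>\<gamma>. \<beta> \<bullet> weight \<gamma>"] unfolding inner_rho by fastforce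

text \<open>Replaces the existential definition of negativity by a single inequality; by
  \<open>root_inner_rho\<close> the opposite strict inequality then describes the positive
  roots.\<close>

lemma negative_root_iff: "negative_root \<Phi> \<Delta> \<beta> \<longleftrightarrow> \<beta> \<in> \<Phi> \<and> \<beta> \<bullet> \<rho> < 0"
proof -
  have "\<beta> \<bullet> \<rho> < 0" if "\<beta> \<in> \<Phi>" "\<forall>\<gamma>\<in>\<Delta>. \<beta> \<bullet> weight \<gamma> \<le> 0"
    using that root_inner_rho[of \<beta>] sum_nonpos[of \<Delta> "\<lambda>\<gamma>. \<beta> \<bullet> weight \<gamma>"] unfolding inner_rho by fastforce
  moreover have "\<beta> \<bullet> weight \<gamma> \<le> 0" if "\<beta> \<in> \<Phi>" "\<beta> \<bullet> \<rho> < 0" "\<gamma> \<in> \<Delta>" for \<gamma>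
    using that positive_root_weight[of "- \<beta>" \<gamma>] uminus_root by auto
  ultimately show ?thesis unfolding negative_root_weight by blast
qed

lemma simple_rho: "\<alpha> \<in> \<Delta> \<Longrightarrow> \<alpha> \<bullet> \<rho> = 1"
  by (simp add: inner_commute[of \<alpha>] face_point_inner)

section \<open>Action on the roots, exchange, and generation by simple reflections\<close>

lemma group_root: "w \<in> W \<Longrightarrow> \<beta> \<in> \<Phi> \<Longrightarrow> w \<beta> \<in> \<Phi>"
proof -
  assume "w \<in> W" "\<beta> \<in> \<Phi>"
  then obtain l where "w = word l" "set l \<subseteq> \<Phi>" by (auto simp: carrier_reflection_group)
  then show "w \<beta> \<in> \<Phi>"
    using \<open>\<beta> \<in> \<Phi>\<close> by (induction l arbitrary: w) (auto simp: reflection_root)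
qed

text \<open>The roots span, so a linear map is determined by how it permutes the finite set
  \<Phi>.\<close>

lemma finite_group: "finite W"
proof -
  have "inj_on (\<lambda>w. restrict w \<Phi>) W"
  proof (rule inj_onI)
    fix u v assume uv: "u \<in> W" "v \<in> W" "restrict u \<Phi> = restrict v \<Phi>"
    then have "u \<beta> = v \<beta>" if "\<beta> \<in> \<Phi>" for \<beta> using that by (metis restrict_apply')
    then have "u x = v x" if "x \<in> span \<Phi>" for x
      using linear_eq_on[OF reflection_group_linear reflection_group_linear that] uv by blast
    then show "u = v" using roots by (auto simp: root_system_def)
  qed
  moreover have "(\<lambda>w. restrict w \<Phi>) ` W \<subseteq> (\<Phi> \<rightarrow>\<^sub>E \<Phi>)" by (auto simp: group_root)
  ultimately show ?thesis
    using finite_roots by (meson finite_PiE finite_imageD finite_subset)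
qed

text \<open>Such a \<beta> lies on the line of \<alpha>, where a reduced root system has only
  \<alpha> and its negative.\<close>

lemma positive_root_in_span:
  assumes "\<beta> \<in> \<Phi>" "\<beta> \<bullet> \<rho> > 0" "\<alpha> \<in> \<Delta>" "\<forall>\<gamma>\<in>\<Delta> - {\<alpha>}. \<beta> \<bullet> weight \<gamma> = 0"
  shows "\<beta> = \<alpha>"
proof -
  have "\<beta> = (\<Sum>\<gamma>\<in>\<Delta>. (\<beta> \<bullet> weight \<gamma>) *\<^sub>R \<gamma>)" by (rule simple_expansion)
  also have "\<dots> = (\<beta> \<bullet> weight \<alpha>) *\<^sub>R \<alpha>"
    using assms finite_simple by (subst sum.remove[OF _ assms(3)]) auto
  finally have "\<beta> \<in> span {\<alpha>}" by (metis span_base span_scale singletonI)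
  then have "\<beta> = \<alpha> \<or> \<beta> = - \<alpha>" using assms simple_subset root_multiple by blast
  then show ?thesis using assms simple_rho[of \<alpha>] by auto
qed

text \<open>Reflecting in \<alpha> changes only the coordinate at \<alpha>. A positive root other
  than \<alpha> has a positive coordinate elsewhere, and this one survives.\<close>

lemma simple_reflection_positive:
  assumes "\<beta> \<in> \<Phi>" "\<beta> \<bullet> \<rho> > 0" "\<alpha> \<in> \<Delta>" "\<beta> \<noteq> \<alpha>"
  shows "reflection \<alpha> \<beta> \<bullet> \<rho> > 0"
proof -
  obtain \<gamma> where \<gamma>: "\<gamma> \<in> \<Delta>" "\<gamma> \<noteq> \<alpha>" "\<beta> \<bullet> weight \<gamma> \<noteq> 0"
    using positive_root_in_span assms by blast
  then have "reflection \<alpha> \<beta> \<bullet> weight \<gamma> > 0"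
    using positive_root_weight[of \<beta> \<gamma>] assms
    by (simp add: reflection_def inner_diff_left inner_commute[of \<alpha> "weight \<gamma>"] weight_inner)
  moreover have r: "reflection \<alpha> \<beta> \<in> \<Phi>" using reflection_root assms simple_subset by auto
  ultimately have "\<not> negative_root \<Phi> \<Delta> (reflection \<alpha> \<beta>)"
    using \<gamma> negative_root_weight by fastforce
  then show ?thesis using r root_inner_rho[OF r] negative_root_iff by force
qed

lemma word_in_group: "set l \<subseteq> \<Delta> \<Longrightarrow> word l \<in> W"
  using simple_subset by (auto simp: carrier_reflection_group)

text \<open>The exchange condition. Apply the letters to \<beta> one by one, starting from the
  right. Just before the first letter a that makes the root negative, the root must be a itself by
  \<open>simple_reflection_positive\<close>. Conjugation then turns the reflection in \<beta> into
  the reflection in a, which cancels this letter.\<close>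

lemma exchange:
  assumes "set l \<subseteq> \<Delta>" "\<beta> \<in> \<Delta>" "word l \<beta> \<bullet> \<rho> < 0"
  shows "\<exists>m. set m \<subseteq> \<Delta> \<and> length m < length l \<and> word l \<circ> reflection \<beta> = word m"
  using assms
proof (induction l)
  case Nil
  then show ?case using simple_rho[of \<beta>] by simp
next
  case (Cons a l)
  have root: "word l \<beta> \<in> \<Phi>"
    using Cons.prems simple_subset group_root[OF word_in_group, of l \<beta>] by auto
  show ?case
  proof (cases "word l \<beta> \<bullet> \<rho> < 0")
    case True
    then obtain m where m: "set m \<subseteq> \<Delta>" "length m < length l" "word l \<circ> reflection \<beta> = word m"
      using Cons.IH[OF _ Cons.prems(2) True] Cons.prems(1) by (metis insert_subset list.set(2))
    then have "word (a # l) \<circ> reflection \<beta> = word (a # m)"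
      by (simp only: word.simps o_assoc[symmetric])
    with Cons.prems m show ?thesis by (intro exI[of _ "a # m"]) (simp del: word.simps)
  next
    case False
    then have "word l \<beta> = a"
      using root_inner_rho[OF root] simple_reflection_positive[OF root, of a] Cons.prems by force
    then have *: "reflection a \<circ> word l = word l \<circ> reflection \<beta>"
      using conjugate_reflection[OF word_in_group, of l \<beta>] Cons.prems by auto
    have "word (a # l) \<circ> reflection \<beta> = word l"
      using fun_cong[OF *] by (auto simp: fun_eq_iff)
    with Cons.prems show ?thesis by (intro exI[of _ l]) (simp del: word.simps)
  qed
qed

text \<open>
  Reflections in simple roots with positive inner product lower the height \<open>\<beta> \<bullet> \<rho>\<close> of a positive
  root until it becomes simple.
\<close>

lemma root_conjugate_simple:
  assumes "\<beta> \<in> \<Phi>" "\<beta> \<bullet> \<rho> > 0"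
  shows "\<exists>w\<in>carrier (reflection_group \<Delta>). w \<beta> \<in> \<Delta>"
proof -
  let ?G = "carrier (reflection_group \<Delta>)"
  define S where "S = {\<gamma>\<in>\<Phi>. \<gamma> \<bullet> \<rho> > 0 \<and> (\<exists>w\<in>?G. w \<beta> = \<gamma>)}"
  have "\<beta> \<in> S" using assms reflection_group_id by (auto simp: S_def intro!: bexI[of _ id])
  moreover have "finite S" using finite_roots by (simp add: S_def)
  ultimately obtain \<gamma> where \<gamma>: "\<gamma> \<in> S" and min: "\<And>\<delta>. \<delta> \<in> S \<Longrightarrow> \<gamma> \<bullet> \<rho> \<le> \<delta> \<bullet> \<rho>"
    using ex_is_arg_min_if_finite[of S "\<lambda>\<gamma>. \<gamma> \<bullet> \<rho>"]
    by (metis (no_types, lifting) arg_min_least empty_iff ex_is_arg_min_if_finite is_arg_min_linorder)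
  then obtain w where w: "w \<in> ?G" "w \<beta> = \<gamma>" by (auto simp: S_def)
  have g: "\<gamma> \<in> \<Phi>" "\<gamma> \<bullet> \<rho> > 0" using \<gamma> by (auto simp: S_def)
  have "\<gamma> \<bullet> \<gamma> > 0" using g zero_notin_roots by auto
  \<comment> \<open>The positive number \<gamma> \<bullet> \<gamma> is the sum of these products, so
    one of them is positive.\<close>
  then obtain \<alpha> where \<alpha>: "\<alpha> \<in> \<Delta>" "(\<gamma> \<bullet> weight \<alpha>) * (\<alpha> \<bullet> \<gamma>) > 0"
    using sum_nonpos[of \<Delta> "\<lambda>\<alpha>. (\<gamma> \<bullet> weight \<alpha>) * (\<alpha> \<bullet> \<gamma>)"] inner_expansion[of \<gamma> \<gamma>] by force
  have pos: "\<alpha> \<bullet> \<gamma> > 0"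
    using \<alpha> positive_root_weight[OF g \<alpha>(1)] by (simp add: zero_less_mult_iff)
  show ?thesis
  proof (cases "\<gamma> = \<alpha>")
    case False
    have "reflection \<alpha> \<gamma> \<in> S"
      using reflection_root g \<alpha> simple_subset simple_reflection_positive[OF g \<alpha>(1) False]
        reflection_group_comp[OF reflection_group_reflection[OF \<alpha>(1)] w(1)] w(2)
      by (auto simp: S_def intro!: bexI[of _ "reflection \<alpha> \<circ> w"])
    from min[OF this] have "2 * (\<gamma> \<bullet> \<alpha>) / (\<alpha> \<bullet> \<alpha>) \<le> 0"
      by (simp add: reflection_def inner_diff_left simple_rho[OF \<alpha>(1)])
    moreover have "\<alpha> \<bullet> \<alpha> > 0" using \<alpha> simple_subset zero_notin_roots by auto
    ultimately show ?thesis using pos by (simp add: inner_commute divide_le_0_iff)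
  qed (use w \<alpha> in auto)
qed

text \<open>By \<open>root_conjugate_simple\<close> the reflection in a positive root is conjugate
  to a simple reflection inside the smaller group; a negative root has the same reflection as its
  negative.\<close>

lemma group_generated_by_simple: "carrier (reflection_group \<Delta>) = W"
proof
  show "carrier (reflection_group \<Delta>) \<subseteq> W"
    by (rule reflection_group_mono[OF simple_subset])
  have pos: "reflection \<beta> \<in> carrier (reflection_group \<Delta>)" if "\<beta> \<in> \<Phi>" "\<beta> \<bullet> \<rho> > 0" for \<beta>
  proof -
    obtain w where w: "w \<in> carrier (reflection_group \<Delta>)" "w \<beta> \<in> \<Delta>"
      using root_conjugate_simple \<open>\<beta> \<in> \<Phi>\<close> \<open>\<beta> \<bullet> \<rho> > 0\<close> by blast
    have "inverse_map w \<circ> (reflection (w \<beta>) \<circ> w) = reflection \<beta>"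
      using w by (auto simp: conjugate_reflection fun_eq_iff reflection_group_inv_left)
    then show ?thesis
      using w by (metis reflection_group_comp reflection_group_inv reflection_group_reflection)
  qed
  have "reflection \<beta> \<in> carrier (reflection_group \<Delta>)" if "\<beta> \<in> \<Phi>" for \<beta>
    using that pos[of \<beta>] pos[of "- \<beta>"] root_inner_rho[of \<beta>] uminus_root[of \<beta>]
    by (cases "\<beta> \<bullet> \<rho> > 0") (auto simp: reflection_uminus)
  then have "word l \<in> carrier (reflection_group \<Delta>)" if "set l \<subseteq> \<Phi>" for l
    using that by (induction l) (simp_all only: word.simps reflection_group_id reflection_group_comp list.set insert_subset)
  then show "W \<subseteq> carrier (reflection_group \<Delta>)"
    by (auto simp: carrier_reflection_group[of \<Phi>])
qed

section \<open>The closed fundamental chamber as a fundamental domain\<close>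

definition dominant :: "'a \<Rightarrow> bool" where
  "dominant q \<longleftrightarrow> (\<forall>\<alpha>\<in>\<Delta>. \<alpha> \<bullet> q \<ge> 0)"

lemma dominant_face_point: "dominant (face_point K)"
  by (simp add: dominant_def inner_commute[of _ "face_point K"] face_point_inner)

lemma dominant_positive_root:
  assumes "dominant q" "\<beta> \<in> \<Phi>" "\<beta> \<bullet> \<rho> > 0"
  shows "\<beta> \<bullet> q \<ge> 0"
proof (subst inner_expansion, rule sum_nonneg)
  fix \<gamma> assume "\<gamma> \<in> \<Delta>"
  then show "0 \<le> \<beta> \<bullet> weight \<gamma> * (\<gamma> \<bullet> q)"
    using assms positive_root_weight[OF assms(2,3)] by (simp add: dominant_def)
qed

lemma dominant_negative_root: "dominant q \<Longrightarrow> \<beta> \<in> \<Phi> \<Longrightarrow> \<beta> \<bullet> \<rho> < 0 \<Longrightarrow> \<beta> \<bullet> q \<le> 0"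
  using dominant_positive_root[of q "- \<beta>"] uminus_root by auto

text \<open>Induction on the length, since the word may fail to be reduced. If it makes a simple
  root \<alpha> negative, then \<alpha> \<bullet> q, which equals the product of that negative root
  with r, is both nonnegative and nonpositive. So the reflection in \<alpha> fixes q and can be
  split off, and exchange shortens the rest.\<close>

lemma dominant_unique_word:
  assumes "set l \<subseteq> \<Delta>" "dominant q" "dominant r" "word l q = r"
  shows "q = r \<and> word l \<in> carrier (reflection_group {\<alpha>\<in>\<Delta>. \<alpha> \<bullet> q = 0})"
  using assms
proof (induction "length l" arbitrary: l rule: less_induct)
  case less
  show ?case
  proof (cases "\<exists>\<alpha>\<in>\<Delta>. word l \<alpha> \<bullet> \<rho> < 0")
    case True
    then obtain \<alpha> where \<alpha>: "\<alpha> \<in> \<Delta>" "word l \<alpha> \<bullet> \<rho> < 0" by blast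
    then obtain m where m: "set m \<subseteq> \<Delta>" "length m < length l" "word l \<circ> reflection \<alpha> = word m"
      using exchange less by blast
    have "word l \<alpha> \<in> \<Phi>"
      using \<alpha> less.prems simple_subset group_root[OF word_in_group, of l \<alpha>] by auto
    then have "word l \<alpha> \<bullet> r \<le> 0" using dominant_negative_root less.prems \<alpha> by blast
    then have "\<alpha> \<bullet> q \<le> 0" using less.prems(4) by (metis inner_word)
    then have q: "\<alpha> \<bullet> q = 0" using less.prems(2) \<alpha> by (force simp: dominant_def)
    then have fixes_q: "reflection \<alpha> q = q" by (simp add: reflection_def inner_commute)
    then have "word m q = r" using less.prems(4) m(3) by (metis comp_apply)
    then have IH: "q = r \<and> word m \<in> carrier (reflection_group {\<alpha>\<in>\<Delta>. \<alpha> \<bullet> q = 0})"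
      using less m by blast
    have "word l = word m \<circ> reflection \<alpha>" using m(3) by (auto simp: fun_eq_iff simp flip: m(3))
    then show ?thesis
      using IH \<alpha> q by (metis (mono_tags, lifting) mem_Collect_eq reflection_group_comp reflection_group_reflection)
  next
    case False
    show ?thesis
    proof (cases l rule: rev_cases)
      case Nil
      then show ?thesis using less.prems reflection_group_id by auto
    next
      \<comment> \<open>The word sends its last letter \<beta> to a positive root, so m sends
        \<beta> to a negative one. Exchange then yields a shorter word for the same element.\<close>
      case (snoc m \<beta>)
      then have \<beta>: "\<beta> \<in> \<Delta>" "set m \<subseteq> \<Delta>" using less.prems by auto
      then have b: "\<beta> \<in> \<Phi>" "\<beta> \<noteq> 0" using simple_subset zero_notin_roots by auto
      have "word l \<beta> = - word m \<beta>"
        using b snoc linear_neg[OF linear_word, of m \<beta>] by (simp add: word_append reflection_self)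
      moreover have "word m \<beta> \<in> \<Phi>" using b \<beta> group_root word_in_group by blast
      ultimately have "word m \<beta> \<bullet> \<rho> < 0"
        using False \<beta> root_inner_rho[of "word m \<beta>"] by (force simp: not_less)
      then obtain k where k: "set k \<subseteq> \<Delta>" "length k < length m" "word m \<circ> reflection \<beta> = word k"
        using exchange \<beta> by blast
      then have lk: "word l = word k" using snoc by (simp add: word_append)
      have "length k < length l" "word k q = r"
        using k(2) snoc less.prems(4) lk by auto
      then show ?thesis
        unfolding lk using less.hyps[OF _ k(1) less.prems(2,3)] by blast
    qed
  qed
qed

lemma dominant_unique:
  assumes "w \<in> W" "dominant q" "dominant (w q)"
  shows "w q = q" "w \<in> carrier (reflection_group {\<alpha>\<in>\<Delta>. \<alpha> \<bullet> q = 0})"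
proof -
  obtain l where l: "w = word l" "set l \<subseteq> \<Delta>"
    using assms(1) group_generated_by_simple carrier_reflection_group[of \<Delta>] by blast
  then show "w q = q" "w \<in> carrier (reflection_group {\<alpha>\<in>\<Delta>. \<alpha> \<bullet> q = 0})"
    using dominant_unique_word[OF l(2) assms(2,3)] by (metis, blast)
qed

text \<open>A translate \<open>w v\<close> with \<open>w v \<bullet> \<rho>\<close> maximal satisfies all inequalities defining the cone of \<open>K\<close>.\<close>

lemma exists_dominant:
  assumes "K \<subseteq> \<Delta>"
  shows "\<exists>w\<in>carrier (reflection_group K). \<forall>\<alpha>\<in>K. \<alpha> \<bullet> w v \<ge> 0"
proof -
  let ?G = "carrier (reflection_group K)"
  have "finite ?G"
    using finite_subset[OF reflection_group_mono finite_group] assms simple_subset by blast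
  moreover have "?G \<noteq> {}" using reflection_group_id by blast
  ultimately have fin: "finite ((\<lambda>w. w v \<bullet> \<rho>) ` ?G)" and ne: "(\<lambda>w. w v \<bullet> \<rho>) ` ?G \<noteq> {}"
    by auto
  from Max_in[OF this] obtain w where w: "w \<in> ?G" and "Max ((\<lambda>w. w v \<bullet> \<rho>) ` ?G) = w v \<bullet> \<rho>"
    by (rule imageE)
  then have max: "u v \<bullet> \<rho> \<le> w v \<bullet> \<rho>" if "u \<in> ?G" for u
    using Max_ge[OF fin imageI[OF that]] by simp
  have "\<alpha> \<bullet> w v \<ge> 0" if \<alpha>: "\<alpha> \<in> K" for \<alpha>
  proof -
    have "(reflection \<alpha> \<circ> w) v \<bullet> \<rho> \<le> w v \<bullet> \<rho>"
      by (rule max[OF reflection_group_comp[OF reflection_group_reflection[OF \<alpha>] w]])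
    \<comment> \<open>Since \<alpha> \<bullet> \<rho> = 1, reflecting in \<alpha> lowers the height
      of w v by exactly this number.\<close>
    then have "2 * (w v \<bullet> \<alpha>) / (\<alpha> \<bullet> \<alpha>) \<ge> 0"
      using simple_rho[of \<alpha>] \<alpha> assms by (auto simp: reflection_def inner_diff_left)
    moreover have "\<alpha> \<bullet> \<alpha> > 0" using \<alpha> assms simple_subset zero_notin_roots by auto
    ultimately show ?thesis by (simp add: zero_le_divide_iff inner_commute)
  qed
  then show ?thesis using w by blast
qed

end

section \<open>Cells of a central arrangement\<close>

abbreviation hyperplane :: "'a::real_inner \<Rightarrow> 'a set" where
  "hyperplane \<alpha> \<equiv> {v. \<alpha> \<bullet> v = 0}"

text \<open>A face is given by one of its points instead of a sign vector, so nonemptiness is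
  automatic. Signs are indexed by roots; \<alpha> and its negative impose the same
  condition.\<close>

definition cell :: "'a::real_inner set \<Rightarrow> 'a \<Rightarrow> 'a set" where
  "cell \<Phi> p = {v. \<forall>\<alpha>\<in>\<Phi>. sgn (\<alpha> \<bullet> v) = sgn (\<alpha> \<bullet> p)}"

definition regular :: "'a::real_inner set \<Rightarrow> 'a \<Rightarrow> bool" where
  "regular \<Phi> c \<longleftrightarrow> (\<forall>\<alpha>\<in>\<Phi>. \<alpha> \<bullet> c \<noteq> 0)"

lemma cell_self [simp]: "p \<in> cell \<Phi> p"
  by (simp add: cell_def)

lemma cell_eq_iff: "cell \<Phi> p = cell \<Phi> q \<longleftrightarrow> (\<forall>\<alpha>\<in>\<Phi>. sgn (\<alpha> \<bullet> p) = sgn (\<alpha> \<bullet> q))"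
  using cell_self[of p \<Phi>] by (auto simp: cell_def)

lemma open_half_spaces_hyperplane:
  fixes \<alpha> :: "'a::real_inner"
  assumes "\<alpha> \<noteq> 0"
  shows "open_half_spaces (hyperplane \<alpha>) = {{v. \<alpha> \<bullet> v < 0}, {v. \<alpha> \<bullet> v > 0}}"
proof
  show "open_half_spaces (hyperplane \<alpha>) \<subseteq> {{v. \<alpha> \<bullet> v < 0}, {v. \<alpha> \<bullet> v > 0}}"
  proof
    fix S assume "S \<in> open_half_spaces (hyperplane \<alpha>)"
    then obtain a b where ab: "a \<noteq> 0" "hyperplane \<alpha> = {v. a \<bullet> v = b}" "S = {v. a \<bullet> v < b}"
      by (auto simp: open_half_spaces_def)
    have iff: "\<alpha> \<bullet> v = 0 \<longleftrightarrow> a \<bullet> v = b" for v using ab(2) by auto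
    from iff[of 0] have b: "b = 0" by simp
    \<comment> \<open>The part p of a orthogonal to \<alpha> lies on the hyperplane, where a
      vanishes as well. Hence p is orthogonal to itself, and a is a multiple of \<alpha>.\<close>
    define c where "c = (a \<bullet> \<alpha>) / (\<alpha> \<bullet> \<alpha>)"
    define p where "p = a - c *\<^sub>R \<alpha>"
    have "\<alpha> \<bullet> p = 0" using assms by (simp add: p_def c_def inner_diff_right inner_commute)
    moreover from this have "a \<bullet> p = 0" using iff b by simp
    ultimately have "p \<bullet> p = 0" by (simp add: p_def inner_diff_left)
    then have a: "a = c *\<^sub>R \<alpha>" by (simp add: p_def)
    then have "c \<noteq> 0" using ab(1) by auto
    then show "S \<in> {{v. \<alpha> \<bullet> v < 0}, {v. \<alpha> \<bullet> v > 0}}"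
      unfolding ab(3) b a by (cases "c > 0") (auto simp: mult_less_0_iff)
  qed
  have "{v. \<alpha> \<bullet> v < 0} \<in> open_half_spaces (hyperplane \<alpha>)"
    unfolding open_half_spaces_def by (rule CollectI, rule exI[of _ \<alpha>], rule exI[of _ 0]) (use assms in simp)
  moreover have "{v. \<alpha> \<bullet> v > 0} \<in> open_half_spaces (hyperplane \<alpha>)"
    unfolding open_half_spaces_def by (rule CollectI, rule exI[of _ "- \<alpha>"], rule exI[of _ 0]) (use assms in simp)
  ultimately show "{{v. \<alpha> \<bullet> v < 0}, {v. \<alpha> \<bullet> v > 0}} \<subseteq> open_half_spaces (hyperplane \<alpha>)"
    by blast
qed

text \<open>One sign equation covers all three choices: if p lies on the hyperplane, it describes
  the hyperplane itself.\<close>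

lemma half_space_of_point:
  assumes "\<alpha> \<noteq> 0"
  shows "(S = hyperplane \<alpha> \<or> S \<in> open_half_spaces (hyperplane \<alpha>)) \<and> p \<in> S \<longleftrightarrow>
    S = {v. sgn (\<alpha> \<bullet> v) = sgn (\<alpha> \<bullet> p)}"
proof -
  consider "\<alpha> \<bullet> p < 0" | "\<alpha> \<bullet> p = 0" | "\<alpha> \<bullet> p > 0" by linarith
  then show ?thesis
    unfolding open_half_spaces_hyperplane[OF assms]
    by cases (auto simp: sgn_if split: if_splits)
qed

lemma open_half_space_of_point:
  assumes "\<alpha> \<bullet> p \<noteq> 0"
  shows "S \<in> open_half_spaces (hyperplane \<alpha>) \<and> p \<in> S \<longleftrightarrow> S = {v. sgn (\<alpha> \<bullet> v) = sgn (\<alpha> \<bullet> p)}"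
proof -
  have "\<alpha> \<noteq> 0" using assms by auto
  moreover have "S \<noteq> hyperplane \<alpha>" if "p \<in> S" using that assms by auto
  ultimately show ?thesis using half_space_of_point[of \<alpha> S p] by blast
qed

lemma cell_INT:
  "cell \<Phi> p = (\<Inter>\<alpha>\<in>\<Phi>. {v. sgn (\<alpha> \<bullet> v) = sgn (\<alpha> \<bullet> p)})"
  by (auto simp: cell_def)

lemma faces_root_arrangement:
  assumes "0 \<notin> \<Phi>"
  shows "faces (root_arrangement \<Phi>) = range (cell \<Phi>)"
proof
  show "faces (root_arrangement \<Phi>) \<subseteq> range (cell \<Phi>)"
  proof
    fix F assume "F \<in> faces (root_arrangement \<Phi>)"
    then obtain \<epsilon> where "F \<noteq> {}" and F: "F = (\<Inter>H\<in>root_arrangement \<Phi>. \<epsilon> H)"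
      and \<epsilon>: "\<forall>H\<in>root_arrangement \<Phi>. \<epsilon> H = H \<or> \<epsilon> H \<in> open_half_spaces H"
      unfolding faces_def by blast
    then obtain p where p: "p \<in> F" by blast
    have "\<epsilon> (hyperplane \<alpha>) = {v. sgn (\<alpha> \<bullet> v) = sgn (\<alpha> \<bullet> p)}" if "\<alpha> \<in> \<Phi>" for \<alpha>
    proof -
      have H: "hyperplane \<alpha> \<in> root_arrangement \<Phi>" using that by (auto simp: root_arrangement_def)
      have nz: "\<alpha> \<noteq> 0" using that assms by auto
      have "p \<in> \<epsilon> (hyperplane \<alpha>)" using p F H by blast
      then show ?thesis using half_space_of_point[OF nz, of "\<epsilon> (hyperplane \<alpha>)" p] bspec[OF \<epsilon> H] by blast
    qed
    then have "F = cell \<Phi> p"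
      unfolding F cell_INT root_arrangement_def by (auto simp: image_image)
    then show "F \<in> range (cell \<Phi>)" by blast
  qed
  have "cell \<Phi> p \<in> faces (root_arrangement \<Phi>)" for p
  proof -
    \<comment> \<open>The choice is made per hyperplane, because two opposite roots share one. By
      \<open>half_space_of_point\<close> the set chosen is unique.\<close>
    define \<epsilon> where "\<epsilon> H = (SOME S. (S = H \<or> S \<in> open_half_spaces H) \<and> p \<in> S)" for H
    have \<epsilon>: "\<epsilon> (hyperplane \<alpha>) = {v. sgn (\<alpha> \<bullet> v) = sgn (\<alpha> \<bullet> p)}" if "\<alpha> \<in> \<Phi>" for \<alpha>
    proof -
      have "\<alpha> \<noteq> 0" using that assms by auto
      then show ?thesis
        unfolding \<epsilon>_def half_space_of_point[OF \<open>\<alpha> \<noteq> 0\<close>] by simp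
    qed
    have "\<epsilon> H = H \<or> \<epsilon> H \<in> open_half_spaces H" if "H \<in> root_arrangement \<Phi>" for H
    proof -
      obtain \<alpha> where \<alpha>: "H = hyperplane \<alpha>" "\<alpha> \<in> \<Phi>"
        using \<open>H \<in> root_arrangement \<Phi>\<close> unfolding root_arrangement_def by (rule imageE)
      with assms have "\<alpha> \<noteq> 0" by auto
      then show ?thesis
        unfolding \<alpha>(1) using half_space_of_point[of \<alpha> "\<epsilon> (hyperplane \<alpha>)" p] \<epsilon>[OF \<alpha>(2)] by blast
    qed
    moreover have "cell \<Phi> p = (\<Inter>H\<in>root_arrangement \<Phi>. \<epsilon> H)"
      unfolding cell_INT root_arrangement_def by (auto simp: image_image \<epsilon>)
    moreover have "cell \<Phi> p \<noteq> {}" using cell_self by blast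
    ultimately show ?thesis unfolding faces_def by blast
  qed
  then show "range (cell \<Phi>) \<subseteq> faces (root_arrangement \<Phi>)" by blast
qed

lemma convex_cell: "convex (cell \<Phi> p)"
proof -
  have "convex {v. sgn (\<alpha> \<bullet> v) = sgn (\<alpha> \<bullet> p)}" for \<alpha>
  proof -
    consider "\<alpha> \<bullet> p < 0" | "\<alpha> \<bullet> p = 0" | "\<alpha> \<bullet> p > 0" by linarith
    then show ?thesis
      by cases (simp_all add: sgn_1_neg sgn_1_pos sgn_0_0 convex_halfspace_lt convex_halfspace_gt convex_hyperplane)
  qed
  then show ?thesis unfolding cell_INT by (intro convex_INT) auto
qed

lemma complement_root_arrangement: "- \<Union>(root_arrangement \<Phi>) = {p. regular \<Phi> p}"
  by (auto simp: root_arrangement_def regular_def)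

lemma regular_cell: "regular \<Phi> p \<Longrightarrow> q \<in> cell \<Phi> p \<Longrightarrow> regular \<Phi> q"
  unfolding regular_def cell_def by (metis (mono_tags, lifting) mem_Collect_eq sgn_0_0)

text \<open>A cell is convex, hence connected. Conversely a root without zeros on a connected
  component cannot change sign there.\<close>

lemma chambers_root_arrangement:
  "chambers (root_arrangement \<Phi>) = cell \<Phi> ` {p. regular \<Phi> p}"
proof -
  let ?S = "{p. regular \<Phi> p}"
  have "connected_component_set ?S p = cell \<Phi> p" if p: "p \<in> ?S" for p
  proof
    show "cell \<Phi> p \<subseteq> connected_component_set ?S p"
      using p regular_cell by (intro connected_component_maximal convex_connected convex_cell) auto
    show "connected_component_set ?S p \<subseteq> cell \<Phi> p"
    proof
      fix q assume q: "q \<in> connected_component_set ?S p"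
      have "sgn (\<alpha> \<bullet> q) = sgn (\<alpha> \<bullet> p)" if \<alpha>: "\<alpha> \<in> \<Phi>" for \<alpha>
      proof -
        let ?I = "(\<lambda>v. \<alpha> \<bullet> v) ` connected_component_set ?S p"
        have "connected ?I"
          by (intro connected_continuous_image continuous_intros connected_connected_component)
        moreover have "\<alpha> \<bullet> p \<in> ?I" "\<alpha> \<bullet> q \<in> ?I"
          using p q by (auto simp: connected_component_refl)
        moreover have "0 \<notin> ?I"
          using \<alpha> connected_component_subset[of ?S p] by (auto simp: regular_def)
        ultimately have "\<not> (\<alpha> \<bullet> p \<le> 0 \<and> 0 \<le> \<alpha> \<bullet> q)" "\<not> (\<alpha> \<bullet> q \<le> 0 \<and> 0 \<le> \<alpha> \<bullet> p)"
          by (metis connectedD_interval)+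
        then show ?thesis by (auto simp: sgn_if)
      qed
      then show "q \<in> cell \<Phi> p" by (simp add: cell_def)
    qed
  qed
  then show ?thesis
    unfolding chambers_def components_def complement_root_arrangement by auto
qed

section \<open>Closures, separation and projection in terms of signs\<close>

lemma cell_subset_closure:
  assumes c: "regular \<Phi> c"
  shows "cell \<Phi> p \<subseteq> closure (cell \<Phi> c) \<longleftrightarrow> (\<forall>\<alpha>\<in>\<Phi>. \<alpha> \<bullet> p \<noteq> 0 \<longrightarrow> sgn (\<alpha> \<bullet> c) = sgn (\<alpha> \<bullet> p))"
proof
  assume sub: "cell \<Phi> p \<subseteq> closure (cell \<Phi> c)"
  show "\<forall>\<alpha>\<in>\<Phi>. \<alpha> \<bullet> p \<noteq> 0 \<longrightarrow> sgn (\<alpha> \<bullet> c) = sgn (\<alpha> \<bullet> p)"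
  proof (intro ballI impI)
    fix \<alpha> assume \<alpha>: "\<alpha> \<in> \<Phi>" "\<alpha> \<bullet> p \<noteq> 0"
    let ?a = "sgn (\<alpha> \<bullet> c) *\<^sub>R \<alpha>"
    \<comment> \<open>Strict inequalities become weak in the closure, so a nonzero sign at p must
      agree with that at c.\<close>
    have "cell \<Phi> c \<subseteq> {v. ?a \<bullet> v \<ge> 0}"
    proof
      fix v assume "v \<in> cell \<Phi> c"
      then have "?a \<bullet> v = \<bar>\<alpha> \<bullet> v\<bar>"
        using \<alpha> by (simp add: cell_def abs_sgn mult.commute)
      then show "v \<in> {v. ?a \<bullet> v \<ge> 0}" by simp
    qed
    then have "closure (cell \<Phi> c) \<subseteq> {v. ?a \<bullet> v \<ge> 0}"
      by (rule closure_minimal) (intro closed_Collect_le continuous_intros)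
    then have "?a \<bullet> p \<ge> 0" using sub cell_self by blast
    moreover have "\<alpha> \<bullet> c \<noteq> 0" using c \<alpha> by (auto simp: regular_def)
    ultimately show "sgn (\<alpha> \<bullet> c) = sgn (\<alpha> \<bullet> p)"
      using \<alpha> by (auto simp: sgn_if split: if_splits)
  qed
next
  assume R: "\<forall>\<alpha>\<in>\<Phi>. \<alpha> \<bullet> p \<noteq> 0 \<longrightarrow> sgn (\<alpha> \<bullet> c) = sgn (\<alpha> \<bullet> p)"
  show "cell \<Phi> p \<subseteq> closure (cell \<Phi> c)"
  proof
    fix q assume q: "q \<in> cell \<Phi> p"
    have "\<exists>y\<in>cell \<Phi> c. dist y q < e" if "e > 0" for e
    proof -
      \<comment> \<open>Only the distance restricts t: the signs are right for every positive t,
        because \<alpha> \<bullet> q is 0 or has the sign of \<alpha> \<bullet> c. The summand 1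
        keeps the denominator positive when c = 0.\<close>
      define t where "t = e / (norm c + 1)"
      have nc: "norm c + 1 > 0" by (simp add: add_nonneg_pos)
      then have t: "t > 0" using that by (simp add: t_def)
      have "sgn (\<alpha> \<bullet> (q + t *\<^sub>R c)) = sgn (\<alpha> \<bullet> c)" if \<alpha>: "\<alpha> \<in> \<Phi>" for \<alpha>
      proof (cases "\<alpha> \<bullet> q = 0")
        case True
        then show ?thesis using t by (simp add: inner_add_right sgn_mult)
      next
        case False
        then have "\<alpha> \<bullet> p \<noteq> 0" "sgn (\<alpha> \<bullet> q) = sgn (\<alpha> \<bullet> p)"
          using q \<alpha> by (auto simp: cell_def) (metis sgn_0_0)
        then have "sgn (\<alpha> \<bullet> q) = sgn (\<alpha> \<bullet> c)" using R \<alpha> by simp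
        then show ?thesis
          using t False by (auto simp: inner_add_right sgn_if add_pos_pos add_neg_neg mult_pos_neg split: if_splits)
            (smt (verit, best) mult_pos_neg mult_pos_pos)+
      qed
      moreover have "dist (q + t *\<^sub>R c) q < e"
        using nc that t by (simp add: dist_norm t_def divide_less_eq distrib_left mult.commute)
      ultimately show ?thesis unfolding cell_def by blast
    qed
    then show "q \<in> closure (cell \<Phi> c)" by (simp add: closure_approachable)
  qed
qed

lemma separating_cells_iff:
  assumes "regular \<Phi> c" "regular \<Phi> d" and \<alpha>: "\<alpha> \<in> \<Phi>"
  shows "hyperplane \<alpha> \<in> separating (root_arrangement \<Phi>) (cell \<Phi> c) (cell \<Phi> d) \<longleftrightarrow>
    sgn (\<alpha> \<bullet> c) \<noteq> sgn (\<alpha> \<bullet> d)"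
    (is "?L \<longleftrightarrow> ?R")
proof -
  have nz: "\<alpha> \<bullet> c \<noteq> 0" "\<alpha> \<bullet> d \<noteq> 0" using assms by (auto simp: regular_def)
  let ?S = "\<lambda>p. {v. sgn (\<alpha> \<bullet> v) = sgn (\<alpha> \<bullet> p)}"
  note iff = open_half_space_of_point[OF nz(1)] open_half_space_of_point[OF nz(2)]
  show ?thesis
  proof
    assume ?L
    then obtain S T where "S \<in> open_half_spaces (hyperplane \<alpha>)" "T \<in> open_half_spaces (hyperplane \<alpha>)"
      and ST: "S \<noteq> T" and "cell \<Phi> c \<subseteq> S" "cell \<Phi> d \<subseteq> T" unfolding separating_def by blast
    moreover have "c \<in> S" "d \<in> T" using calculation cell_self by blast+
    ultimately have "S = ?S c" "T = ?S d" using iff by blast+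
    with ST show ?R by auto
  next
    assume R: ?R
    have "?S c \<in> open_half_spaces (hyperplane \<alpha>)" "?S d \<in> open_half_spaces (hyperplane \<alpha>)"
      using iff by blast+
    moreover have "c \<in> ?S c" "c \<notin> ?S d" using R by auto
    then have "?S c \<noteq> ?S d" by blast
    moreover have "cell \<Phi> c \<subseteq> ?S c" "cell \<Phi> d \<subseteq> ?S d" using \<alpha> by (auto simp: cell_def)
    moreover have "hyperplane \<alpha> \<in> root_arrangement \<Phi>" using \<alpha> by (simp add: root_arrangement_def)
    ultimately show ?L
      unfolding separating_def by (intro CollectI bexI[of _ "?S c"] bexI[of _ "?S d"] conjI)
  qed
qed

text \<open>\<open>p + t c\<close> with small \<open>t > 0\<close> lies in the projection of the chamber of \<open>c\<close> to the face of \<open>p\<close>.\<close>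

lemma projection_exists:
  assumes "finite \<Phi>"
  shows "\<exists>e. \<forall>\<alpha>\<in>\<Phi>. sgn (\<alpha> \<bullet> e) = (if \<alpha> \<bullet> p = 0 then sgn (\<alpha> \<bullet> c) else sgn (\<alpha> \<bullet> p))"
proof -
  have "\<forall>\<^sub>F t in at_right (0::real). sgn (\<alpha> \<bullet> (p + t *\<^sub>R c)) = (if \<alpha> \<bullet> p = 0 then sgn (\<alpha> \<bullet> c) else sgn (\<alpha> \<bullet> p))"
    for \<alpha>
  proof (cases "\<alpha> \<bullet> p = 0")
    case True
    have "\<forall>\<^sub>F t in at_right (0::real). t > 0" by (rule eventually_at_right_less)
    then show ?thesis
      by eventually_elim (use True in \<open>simp add: inner_add_right sgn_mult\<close>)
  next
    case False
    have lim: "((\<lambda>t. \<alpha> \<bullet> (p + t *\<^sub>R c)) \<longlongrightarrow> \<alpha> \<bullet> (p + 0 *\<^sub>R c)) (at_right 0)"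
      by (intro tendsto_intros)
    show ?thesis
    proof (cases "\<alpha> \<bullet> p > 0")
      case True
      then have "\<forall>\<^sub>F t in at_right 0. \<alpha> \<bullet> (p + t *\<^sub>R c) > 0"
        using lim by (intro order_tendstoD(1)[OF lim]) simp
      then show ?thesis by eventually_elim (use True in auto)
    next
      case neg: False
      then have "\<forall>\<^sub>F t in at_right 0. \<alpha> \<bullet> (p + t *\<^sub>R c) < 0"
        using False by (intro order_tendstoD(2)[OF lim]) simp
      then show ?thesis by eventually_elim (use neg False in auto)
    qed
  qed
  then have "\<forall>\<^sub>F t in at_right (0::real). \<forall>\<alpha>\<in>\<Phi>. sgn (\<alpha> \<bullet> (p + t *\<^sub>R c)) =
      (if \<alpha> \<bullet> p = 0 then sgn (\<alpha> \<bullet> c) else sgn (\<alpha> \<bullet> p))"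
    by (intro eventually_ball_finite assms) auto
  then show ?thesis
    using eventually_happens'[OF trivial_limit_at_right_real] by blast
qed

text \<open>All chambers whose closure contains the face have the same signs at roots not vanishing
  on it. The chamber that copies the signs of c at the other roots is separated from c by a subset
  of the hyperplanes that separate any competitor from c.\<close>

lemma moves_cells_iff:
  assumes fin: "finite \<Phi>" and c: "regular \<Phi> c" and d: "regular \<Phi> d"
  shows "moves (root_arrangement \<Phi>) (cell \<Phi> p) (cell \<Phi> c) (cell \<Phi> d) \<longleftrightarrow>
    (\<forall>\<alpha>\<in>\<Phi>. sgn (\<alpha> \<bullet> d) = (if \<alpha> \<bullet> p = 0 then sgn (\<alpha> \<bullet> c) else sgn (\<alpha> \<bullet> p)))"
proof -
  let ?A = "root_arrangement \<Phi>"
  let ?sep = "\<lambda>e. separating ?A (cell \<Phi> c) (cell \<Phi> e)"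
  define proj where "proj e \<longleftrightarrow>
    (\<forall>\<alpha>\<in>\<Phi>. sgn (\<alpha> \<bullet> e) = (if \<alpha> \<bullet> p = 0 then sgn (\<alpha> \<bullet> c) else sgn (\<alpha> \<bullet> p)))" for e
  have finsep: "finite (?sep e)" for e
    using fin by (simp add: separating_def root_arrangement_def)
  have sub: "?sep e \<subseteq> ?sep f"
    if "proj e" "regular \<Phi> e" "regular \<Phi> f" "cell \<Phi> p \<subseteq> closure (cell \<Phi> f)" for e f
  proof
    fix H assume H: "H \<in> ?sep e"
    then have "H \<in> hyperplane ` \<Phi>" unfolding separating_def root_arrangement_def by blast
    then obtain \<alpha> where \<alpha>: "H = hyperplane \<alpha>" "\<alpha> \<in> \<Phi>" by (rule imageE)
    with H have "sgn (\<alpha> \<bullet> c) \<noteq> sgn (\<alpha> \<bullet> e)"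
      using separating_cells_iff[OF c that(2)] by blast
    with that \<alpha> have "sgn (\<alpha> \<bullet> c) \<noteq> sgn (\<alpha> \<bullet> f)"
      unfolding proj_def cell_subset_closure[OF that(3)] by metis
    then show "H \<in> ?sep f"
      unfolding \<alpha>(1) using separating_cells_iff[OF c that(3) \<alpha>(2)] by blast
  qed
  have closed: "cell \<Phi> p \<subseteq> closure (cell \<Phi> e)" if "proj e" "regular \<Phi> e" for e
    using that by (auto simp: cell_subset_closure proj_def)
  have "proj d" if m: "moves ?A (cell \<Phi> p) (cell \<Phi> c) (cell \<Phi> d)"
  proof -
    \<comment> \<open>The projection e is itself a competitor. If it differed from d, minimality of
      d would be strict, against the inclusion \<open>sub\<close>.\<close>
    obtain e where e: "proj e" using projection_exists[OF fin] unfolding proj_def by blast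
    have re: "regular \<Phi> e"
      using e c unfolding proj_def regular_def by (metis (full_types) sgn_0_0)
    then have "cell \<Phi> e \<in> chambers ?A" by (simp add: chambers_root_arrangement)
    have "cell \<Phi> e = cell \<Phi> d"
    proof (rule ccontr)
      assume "cell \<Phi> e \<noteq> cell \<Phi> d"
      then have "card (?sep d) < card (?sep e)"
        using m closed[OF e re] \<open>cell \<Phi> e \<in> chambers ?A\<close> unfolding moves_def by blast
      moreover have "card (?sep e) \<le> card (?sep d)"
        using m by (intro card_mono finsep sub e re d) (auto simp: moves_def)
      ultimately show False by simp
    qed
    then show ?thesis using e by (simp add: proj_def cell_eq_iff)
  qed
  moreover have "moves ?A (cell \<Phi> p) (cell \<Phi> c) (cell \<Phi> d)" if P: "proj d"
    unfolding moves_def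
  proof (intro conjI ballI impI)
    show "cell \<Phi> d \<in> chambers ?A" using d by (auto simp: chambers_root_arrangement)
    show "cell \<Phi> p \<subseteq> closure (cell \<Phi> d)" by (rule closed[OF P d])
    fix D assume "D \<in> chambers ?A" and D: "cell \<Phi> p \<subseteq> closure D \<and> D \<noteq> cell \<Phi> d"
    then obtain f where f: "D = cell \<Phi> f" "regular \<Phi> f" by (auto simp: chambers_root_arrangement)
    then obtain \<alpha> where \<alpha>: "\<alpha> \<in> \<Phi>" "sgn (\<alpha> \<bullet> f) \<noteq> sgn (\<alpha> \<bullet> d)" using D by (auto simp: cell_eq_iff)
    \<comment> \<open>Both f and d have the signs of p off the face, so they differ at a root
      vanishing at p. There d agrees with c, which makes the inclusion of separating sets
      strict.\<close>
    have clf: "\<forall>\<alpha>\<in>\<Phi>. \<alpha> \<bullet> p \<noteq> 0 \<longrightarrow> sgn (\<alpha> \<bullet> f) = sgn (\<alpha> \<bullet> p)"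
      using D f cell_subset_closure by blast
    then have eq: "sgn (\<alpha> \<bullet> d) = sgn (\<alpha> \<bullet> c)" using P \<alpha> by (auto simp: proj_def)
    have "hyperplane \<alpha> \<in> ?sep f" "hyperplane \<alpha> \<notin> ?sep d"
      using separating_cells_iff[OF c f(2) \<alpha>(1)] separating_cells_iff[OF c d \<alpha>(1)] \<alpha>(2) eq by auto
    moreover have "?sep d \<subseteq> ?sep f" using sub[OF P d f(2)] D f(1) by blast
    ultimately have "?sep d \<subset> ?sep f" by blast
    then show "card (?sep d) < card (separating ?A (cell \<Phi> c) D)"
      unfolding f(1) by (intro psubset_card_mono finsep)
  qed
  ultimately show ?thesis unfolding proj_def by blast
qed

lemma supp_flat_cell:
  "supp_flat (root_arrangement \<Phi>) (cell \<Phi> p) = {v. \<forall>\<alpha>\<in>\<Phi>. \<alpha> \<bullet> p = 0 \<longrightarrow> \<alpha> \<bullet> v = 0}"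
proof -
  have "cell \<Phi> p \<subseteq> hyperplane \<alpha> \<longleftrightarrow> \<alpha> \<bullet> p = 0" if "\<alpha> \<in> \<Phi>" for \<alpha>
  proof
    show "\<alpha> \<bullet> p = 0" if "cell \<Phi> p \<subseteq> hyperplane \<alpha>" using that cell_self by blast
    show "cell \<Phi> p \<subseteq> hyperplane \<alpha>" if "\<alpha> \<bullet> p = 0"
      using that \<open>\<alpha> \<in> \<Phi>\<close> by (force simp: cell_def sgn_0_0)
  qed
  then have "{H \<in> root_arrangement \<Phi>. cell \<Phi> p \<subseteq> H} = hyperplane ` {\<alpha>\<in>\<Phi>. \<alpha> \<bullet> p = 0}"
    unfolding root_arrangement_def by blast
  then show ?thesis by (auto simp: supp_flat_def)
qed

section \<open>Symmetries of the intersection poset\<close>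

text \<open>f acts on L as an automorphism of the order, and the recursion sees nothing but the
  order.\<close>

lemma moebius_image:
  assumes f: "inj f" and "(`) f ` L = L"
  shows "moebius L (f ` X) (f ` Y) = moebius L X Y"
  using assms(2)
proof (induction L X Y rule: moebius.induct)
  case (1 L X Y)
  show ?case
  proof (cases "infinite L \<or> \<not> Y \<subseteq> X \<or> X = Y")
    case True
    then show ?thesis
      using f by (auto simp: moebius.simps[of L "f ` X"] moebius.simps[of L X] inj_image_subset_iff)
  next
    case False
    have "{Z. Z \<in> L \<and> Z \<subseteq> f ` X \<and> f ` Y \<subset> Z} = (`) f ` {Z. Z \<in> L \<and> Z \<subseteq> X \<and> Y \<subset> Z}" (is "?M = (`) f ` ?N")
    proof
      show "(`) f ` ?N \<subseteq> ?M"
        using 1(2) f by (auto simp: inj_image_subset_iff psubset_eq inj_image_eq_iff)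
      show "?M \<subseteq> (`) f ` ?N"
      proof
        fix Z assume Z: "Z \<in> ?M"
        then have "Z \<in> (`) f ` L" using 1(2) by simp
        then obtain Z' where "Z = f ` Z'" "Z' \<in> L" by (rule imageE)
        then show "Z \<in> (`) f ` ?N" using Z f by (auto simp: inj_image_subset_iff psubset_eq inj_image_eq_iff)
      qed
    qed
    then have "(\<Sum>Z\<in>?M. moebius L (f ` X) Z) = (\<Sum>Z\<in>?N. moebius L (f ` X) (f ` Z))"
      using f by (simp add: sum.reindex inj_on_def inj_image_eq_iff)
    also have "\<dots> = (\<Sum>Z\<in>?N. moebius L X Z)"
      using False by (intro sum.cong 1(1) refl 1(2)) auto
    finally show ?thesis
      using False f by (simp add: moebius.simps[of L "f ` X"] moebius.simps[of L X] inj_image_subset_iff inj_image_eq_iff)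
  qed
qed

lemma dim_image_linear_inj:
  fixes f :: "'a::real_vector \<Rightarrow> 'b::real_vector"
  assumes "linear f" "inj f"
  shows "dim (f ` V) = dim V"
proof -
  obtain B where B: "B \<subseteq> V" "independent B" "V \<subseteq> span B" "card B = dim V"
    using basis_exists by blast
  have "dim (f ` V) = card (f ` B)"
  proof (rule dim_unique)
    show "f ` B \<subseteq> f ` V" using B by blast
    show "f ` V \<subseteq> span (f ` B)" using B(3) linear_span_image[OF assms(1)] by blast
    show "independent (f ` B)" using B assms by (simp add: linear_independent_injective_image inj_on_subset)
  qed simp
  also have "card (f ` B) = card B" using assms(2) by (meson card_image inj_on_subset top_greatest)
  finally show ?thesis using B by simp
qed

lemma flat_dim_image:
  assumes "linear f" "inj f"
  shows "flat_dim (f ` Y) = flat_dim Y"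
proof -
  have "{u - v | u v. u \<in> f ` Y \<and> v \<in> f ` Y} = f ` {u - v | u v. u \<in> Y \<and> v \<in> Y}"
    by (auto simp: linear_diff[OF assms(1)] image_iff) (metis linear_diff[OF assms(1)])+
  then show ?thesis by (simp add: flat_dim_def dim_image_linear_inj[OF assms])
qed

text \<open>Images under a bijection commute with intersections; for the empty family, whose
  intersection is the whole space, this is surjectivity. The reverse inclusion applies the same
  argument to the inverse map.\<close>

lemma intersection_poset_image:
  assumes f: "bij f" and A: "(`) f ` A = A"
  shows "(`) f ` intersection_poset A = intersection_poset A"
proof -
  have 1: "(`) f ` intersection_poset A \<subseteq> intersection_poset A" if f: "bij f" and A: "(`) f ` A \<subseteq> A" for f
  proof clarify
    fix Y assume "Y \<in> intersection_poset A"
    then obtain B where B: "B \<subseteq> A" "Y = \<Inter>B" "\<Inter>B \<noteq> {}" by (auto simp: intersection_poset_def)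
    have "f ` \<Inter>B = \<Inter>((`) f ` B)" using bij_image_INT[OF f, of id B] by simp
    then show "f ` Y \<in> intersection_poset A"
      unfolding intersection_poset_def using B A by (intro CollectI exI[of _ "(`) f ` B"] conjI) (blast | simp)+
  qed
  show ?thesis
  proof
    show "(`) f ` intersection_poset A \<subseteq> intersection_poset A" using 1 f A by simp
    let ?g = "inverse_map f"
    have g: "bij ?g" using f by (rule bij_imp_bij_inv)
    have "?g ` f ` H = H" for H using f by (simp add: bij_is_inj image_inv_f_f)
    then have "(`) ?g ` (`) f ` A = A" by (simp add: image_image)
    then have "(`) ?g ` intersection_poset A \<subseteq> intersection_poset A"
      using A by (intro 1 g) simp
    moreover have "f ` ?g ` Y = Y" for Y using f by (simp add: bij_is_surj image_f_inv_f)
    ultimately show "intersection_poset A \<subseteq> (`) f ` intersection_poset A" by (metis image_subset_iff imageI subsetI)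
  qed
qed

text \<open>Needed because the support of a translated face is a translate of Fix(W_K), whereas
  \<open>coxeter_H\<close> refers to Fix(W_K) itself.\<close>

lemma flat_char_poly_image:
  assumes "linear f" "bij f" "(`) f ` A = A"
  shows "flat_char_poly A (f ` X) x = flat_char_poly A X x"
proof -
  let ?L = "intersection_poset A"
  have inj: "inj f" using assms bij_is_inj by blast
  have L: "(`) f ` ?L = ?L" using intersection_poset_image assms by blast
  have "{Y. Y \<in> ?L \<and> Y \<subseteq> f ` X} = (`) f ` {Y. Y \<in> ?L \<and> Y \<subseteq> X}"
    (is "?M = (`) f ` ?N")
  proof
    show "(`) f ` ?N \<subseteq> ?M"
      using L inj by (auto simp: inj_image_subset_iff)
    show "?M \<subseteq> (`) f ` ?N"
    proof
      fix Z assume Z: "Z \<in> ?M"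
      then have "Z \<in> (`) f ` ?L" using L by simp
      then obtain Z' where "Z = f ` Z'" "Z' \<in> ?L" by (rule imageE)
      then show "Z \<in> (`) f ` ?N" using Z inj by (auto simp: inj_image_subset_iff)
    qed
  qed
  then have "flat_char_poly A (f ` X) x =
      (\<Sum>Y\<in>(`) f ` {Y. Y \<in> ?L \<and> Y \<subseteq> X}. of_int (moebius ?L (f ` X) Y) * x ^ flat_dim Y)"
    unfolding flat_char_poly_def by simp
  also have "\<dots> = flat_char_poly A X x"
    unfolding flat_char_poly_def using inj
    by (subst sum.reindex) (auto simp: inj_on_def inj_image_eq_iff moebius_image[OF inj L] flat_dim_image[OF assms(1) inj])
  finally show ?thesis .
qed

section \<open>Faces of a reflection arrangement\<close>

context simple_roots
begin

abbreviation "\<A> \<equiv> root_arrangement \<Phi>"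

abbreviation "fundamental_face K \<equiv> cell \<Phi> (face_point K)"

text \<open>Fix(W_K) given by its equations, as \<open>fixed_space_parabolic\<close> shows for K
  \<subseteq> \<Delta>. The equations also make sense for images of K, whose elements need not be
  simple.\<close>

definition flat :: "'a set \<Rightarrow> 'a set" where
  "flat K = {v. \<forall>\<alpha>\<in>K. \<alpha> \<bullet> v = 0}"

lemma inverse_map_inverse_map: "w \<in> W \<Longrightarrow> inverse_map (inverse_map w) = w"
  by (simp add: inv_inv_eq reflection_group_bij)

lemma image_roots: "w \<in> W \<Longrightarrow> w ` \<Phi> = \<Phi>"
proof
  assume w: "w \<in> W"
  then show "w ` \<Phi> \<subseteq> \<Phi>" using group_root by blast
  show "\<Phi> \<subseteq> w ` \<Phi>"
  proof
    fix \<beta> assume "\<beta> \<in> \<Phi>"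
    then have "inverse_map w \<beta> \<in> \<Phi>" using group_root[OF reflection_group_inv[OF w]] by blast
    then show "\<beta> \<in> w ` \<Phi>" using reflection_group_inv_right[OF w] by (metis imageI)
  qed
qed

lemma mem_image_group: "w \<in> W \<Longrightarrow> v \<in> w ` S \<longleftrightarrow> inverse_map w v \<in> S"
  using reflection_group_inv_left[of w] reflection_group_inv_right[of w] by (metis image_iff)

lemma image_cell:
  assumes w: "w \<in> W"
  shows "w ` cell \<Phi> p = cell \<Phi> (w p)"
proof -
  have "v \<in> w ` cell \<Phi> p \<longleftrightarrow> v \<in> cell \<Phi> (w p)" for v
  proof -
    have "v \<in> w ` cell \<Phi> p \<longleftrightarrow> (\<forall>\<alpha>\<in>\<Phi>. sgn (\<alpha> \<bullet> inverse_map w v) = sgn (\<alpha> \<bullet> p))"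
      by (simp add: mem_image_group[OF w] cell_def)
    also have "\<dots> \<longleftrightarrow> (\<forall>\<alpha>\<in>\<Phi>. sgn (w \<alpha> \<bullet> v) = sgn (w \<alpha> \<bullet> w p))"
      using w by (simp add: reflection_group_inner reflection_group_inner_swap[of w _ _ v])
    also have "\<dots> \<longleftrightarrow> (\<forall>\<beta>\<in>w ` \<Phi>. sgn (\<beta> \<bullet> v) = sgn (\<beta> \<bullet> w p))"
      by simp
    finally show ?thesis by (simp add: image_roots[OF w] cell_def)
  qed
  then show ?thesis by blast
qed

lemma flat_image:
  assumes "w \<in> W"
  shows "flat (w ` K) = w ` flat K"
proof -
  have "v \<in> flat (w ` K) \<longleftrightarrow> v \<in> w ` flat K" for v
    by (simp add: flat_def mem_image_group[OF assms] reflection_group_inner_swap[OF assms])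
  then show ?thesis by blast
qed

lemma image_arrangement:
  assumes w: "w \<in> W"
  shows "(`) w ` \<A> = \<A>"
proof -
  have "w ` hyperplane \<alpha> = hyperplane (w \<alpha>)" for \<alpha>
    using flat_image[OF w, of "{\<alpha>}"] by (simp add: flat_def)
  then have "(`) w ` \<A> = hyperplane ` w ` \<Phi>"
    by (simp add: root_arrangement_def image_image)
  then show ?thesis by (simp add: image_roots[OF w] root_arrangement_def)
qed

section \<open>Faces of the closed fundamental chamber\<close>

lemma dominant_root_zero_iff:
  assumes "dominant q" "\<beta> \<in> \<Phi>" "\<beta> \<bullet> \<rho> > 0"
  shows "\<beta> \<bullet> q = 0 \<longleftrightarrow> (\<forall>\<gamma>\<in>\<Delta>. \<gamma> \<bullet> q \<noteq> 0 \<longrightarrow> \<beta> \<bullet> weight \<gamma> = 0)"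
proof -
  \<comment> \<open>All terms of the expansion are nonnegative, so the sum vanishes only if each
    term does.\<close>
  have "\<beta> \<bullet> q = 0 \<longleftrightarrow> (\<forall>\<gamma>\<in>\<Delta>. \<beta> \<bullet> weight \<gamma> * (\<gamma> \<bullet> q) = 0)"
    by (subst inner_expansion, subst sum_nonneg_eq_0_iff[OF finite_simple])
      (use assms positive_root_weight[OF assms(2,3)] in \<open>auto simp: dominant_def\<close>)
  then show ?thesis by auto
qed

text \<open>At a dominant vector a positive root is nonnegative, and whether it vanishes depends
  only on which simple roots vanish. Hence these faces correspond to subsets of \<Delta>.\<close>

lemma cell_dominant:
  assumes q: "dominant q" and r: "dominant r" and eq: "\<forall>\<alpha>\<in>\<Delta>. \<alpha> \<bullet> q = 0 \<longleftrightarrow> \<alpha> \<bullet> r = 0"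
  shows "cell \<Phi> q = cell \<Phi> r"
proof -
  have pos: "sgn (\<beta> \<bullet> q) = sgn (\<beta> \<bullet> r)" if \<beta>: "\<beta> \<in> \<Phi>" "\<beta> \<bullet> \<rho> > 0" for \<beta>
  proof -
    have "\<beta> \<bullet> q = 0 \<longleftrightarrow> \<beta> \<bullet> r = 0"
      using dominant_root_zero_iff[OF q \<beta>] dominant_root_zero_iff[OF r \<beta>] eq by blast
    moreover have "\<beta> \<bullet> q \<ge> 0" "\<beta> \<bullet> r \<ge> 0"
      using dominant_positive_root q r \<beta> by blast+
    ultimately show ?thesis by (simp add: sgn_if)
  qed
  have "sgn (\<beta> \<bullet> q) = sgn (\<beta> \<bullet> r)" if "\<beta> \<in> \<Phi>" for \<beta>
  proof (cases "\<beta> \<bullet> \<rho> > 0")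
    case False
    then have "(- \<beta>) \<bullet> \<rho> > 0" using root_inner_rho[OF that] by simp
    from pos[OF uminus_root[OF that] this] show ?thesis by (simp add: sgn_minus)
  qed (use pos that in blast)
  then show ?thesis by (simp add: cell_eq_iff)
qed

lemma inner_face_point: "\<alpha> \<in> \<Delta> \<Longrightarrow> \<alpha> \<bullet> face_point K = (if \<alpha> \<in> K then 0 else 1)"
  by (simp add: face_point_inner inner_commute[of \<alpha>])

lemma cell_dominant_face_point:
  assumes "dominant q"
  shows "cell \<Phi> q = fundamental_face {\<alpha>\<in>\<Delta>. \<alpha> \<bullet> q = 0}"
  by (rule cell_dominant[OF assms dominant_face_point]) (simp add: inner_face_point)

lemma fundamental_face_eqD:
  assumes "fundamental_face J = fundamental_face K" "J \<subseteq> \<Delta>" "K \<subseteq> \<Delta>"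
  shows "J = K"
proof -
  have "\<alpha> \<in> J \<longleftrightarrow> \<alpha> \<in> K" if \<alpha>: "\<alpha> \<in> \<Delta>" for \<alpha>
  proof -
    have "sgn (\<alpha> \<bullet> face_point J) = sgn (\<alpha> \<bullet> face_point K)"
      using assms(1) \<alpha> simple_subset by (auto simp: cell_eq_iff)
    then show ?thesis using \<alpha> by (simp add: inner_face_point split: if_splits)
  qed
  then show ?thesis using assms by blast
qed

text \<open>The right-hand side says that \<beta> is a combination of simple roots in K.\<close>

lemma root_face_point_zero_iff:
  assumes "\<beta> \<in> \<Phi>"
  shows "\<beta> \<bullet> face_point K = 0 \<longleftrightarrow> (\<forall>\<gamma>\<in>\<Delta> - K. \<beta> \<bullet> weight \<gamma> = 0)"
proof -
  have pos: "\<beta> \<bullet> face_point K = 0 \<longleftrightarrow> (\<forall>\<gamma>\<in>\<Delta> - K. \<beta> \<bullet> weight \<gamma> = 0)" if "\<beta> \<in> \<Phi>" "\<beta> \<bullet> \<rho> > 0" for \<beta>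
    using dominant_root_zero_iff[OF dominant_face_point that, of K] by (auto simp: inner_face_point)
  show ?thesis
  proof (cases "\<beta> \<bullet> \<rho> > 0")
    case False
    then have "(- \<beta>) \<bullet> \<rho> > 0" using root_inner_rho[OF assms] by simp
    from pos[OF uminus_root[OF assms] this] show ?thesis by simp
  qed (use pos assms in blast)
qed

lemma face_point_in_flat: "K \<subseteq> \<Delta> \<Longrightarrow> face_point K \<in> flat K"
  by (auto simp: flat_def inner_face_point)

text \<open>The roots vanishing on this face are combinations of K, so their equations follow from
  those of K.\<close>

lemma supp_flat_fundamental_face:
  assumes "K \<subseteq> \<Delta>"
  shows "supp_flat \<A> (fundamental_face K) = flat K"
proof -
  have "\<beta> \<bullet> v = 0" if "\<beta> \<in> \<Phi>" "\<beta> \<bullet> face_point K = 0" "v \<in> flat K" for \<beta> v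
  proof -
    have "\<beta> \<bullet> weight \<gamma> * (\<gamma> \<bullet> v) = 0" if "\<gamma> \<in> \<Delta>" for \<gamma>
      using that \<open>v \<in> flat K\<close> \<open>\<beta> \<bullet> face_point K = 0\<close> root_face_point_zero_iff[OF \<open>\<beta> \<in> \<Phi>\<close>, of K]
      by (cases "\<gamma> \<in> K") (auto simp: flat_def)
    then show ?thesis by (subst inner_expansion) (rule sum.neutral, blast)
  qed
  moreover have "v \<in> flat K" if "\<forall>\<alpha>\<in>\<Phi>. \<alpha> \<bullet> face_point K = 0 \<longrightarrow> \<alpha> \<bullet> v = 0" for v
    using that assms simple_subset unfolding flat_def by (auto simp: inner_face_point subset_iff)
  ultimately show ?thesis unfolding supp_flat_cell by blast
qed

lemma supp_flat_image:
  assumes w: "w \<in> W"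
  shows "supp_flat \<A> (w ` cell \<Phi> p) = w ` supp_flat \<A> (cell \<Phi> p)"
proof -
  have "v \<in> supp_flat \<A> (w ` cell \<Phi> p) \<longleftrightarrow> v \<in> w ` supp_flat \<A> (cell \<Phi> p)" for v
  proof -
    have "v \<in> supp_flat \<A> (w ` cell \<Phi> p) \<longleftrightarrow> (\<forall>\<beta>\<in>w ` \<Phi>. \<beta> \<bullet> w p = 0 \<longrightarrow> \<beta> \<bullet> v = 0)"
      by (simp add: image_cell[OF w] image_roots[OF w] supp_flat_cell)
    also have "\<dots> \<longleftrightarrow> (\<forall>\<alpha>\<in>\<Phi>. \<alpha> \<bullet> p = 0 \<longrightarrow> \<alpha> \<bullet> inverse_map w v = 0)"
      using w by (simp add: reflection_group_inner reflection_group_inner_swap[of w _ _ v])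
    finally show ?thesis by (simp add: mem_image_group[OF w] supp_flat_cell)
  qed
  then show ?thesis by blast
qed

section \<open>Which faces move the identity chamber to the chamber of w\<close>

lemma id_in_group: "id \<in> W"
  by (rule reflection_group_id)

lemma regular_group_rho: "w \<in> W \<Longrightarrow> regular \<Phi> (w \<rho>)"
  using group_root[OF reflection_group_inv] root_inner_rho
  by (auto simp: regular_def reflection_group_inner_swap')

lemma chamber_of_cell:
  assumes w: "w \<in> W"
  shows "chamber_of \<Delta> w = cell \<Phi> (w \<rho>)"
proof -
  have "{v. \<forall>\<alpha>\<in>\<Delta>. v \<bullet> \<alpha> > 0} = cell \<Phi> \<rho>"
  proof
    show "{v. \<forall>\<alpha>\<in>\<Delta>. v \<bullet> \<alpha> > 0} \<subseteq> cell \<Phi> \<rho>"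
    proof
      fix v assume "v \<in> {v. \<forall>\<alpha>\<in>\<Delta>. v \<bullet> \<alpha> > 0}"
      then have v: "\<forall>\<alpha>\<in>\<Delta>. \<alpha> \<bullet> v > 0" by (simp add: inner_commute)
      have "cell \<Phi> v = cell \<Phi> \<rho>"
        using v by (intro cell_dominant dominant_face_point) (auto simp: dominant_def inner_face_point less_imp_le)
      then show "v \<in> cell \<Phi> \<rho>" using cell_self by blast
    qed
    show "cell \<Phi> \<rho> \<subseteq> {v. \<forall>\<alpha>\<in>\<Delta>. v \<bullet> \<alpha> > 0}"
    proof clarify
      fix v \<alpha> assume "v \<in> cell \<Phi> \<rho>" "\<alpha> \<in> \<Delta>"
      then have "sgn (\<alpha> \<bullet> v) = 1" using simple_subset by (auto simp: cell_def simple_rho)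
      then show "v \<bullet> \<alpha> > 0" by (simp add: sgn_1_pos inner_commute)
    qed
  qed
  then show ?thesis by (simp add: chamber_of_def image_cell[OF w])
qed

lemma moves_chamber_iff:
  assumes w: "w \<in> W"
  shows "moves \<A> (cell \<Phi> p) (chamber_of \<Delta> id) (chamber_of \<Delta> w) \<longleftrightarrow>
    (\<exists>K \<subseteq> \<Delta> - Des \<Phi> \<Delta> w. cell \<Phi> p = w ` fundamental_face K)"
proof -
  \<comment> \<open>The sign criterion of \<open>moves_cells_iff\<close> for the face of
    \<open>w p\<close>, with every root written as \<open>w \<alpha>\<close> so that w disappears
    from all products except those with \<rho>.\<close>
  define proj where "proj p \<longleftrightarrow> (\<forall>\<alpha>\<in>\<Phi>. sgn (\<alpha> \<bullet> \<rho>) =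
    (if \<alpha> \<bullet> p = 0 then sgn (w \<alpha> \<bullet> \<rho>) else sgn (\<alpha> \<bullet> p)))" for p
  have simp_pos: "w \<alpha> \<bullet> \<rho> > 0 \<longleftrightarrow> \<alpha> \<notin> Des \<Phi> \<Delta> w" if "\<alpha> \<in> \<Delta>" for \<alpha>
  proof -
    have "w \<alpha> \<in> \<Phi>" using that group_root[OF w] simple_subset by blast
    then show ?thesis
      using that root_inner_rho[of "w \<alpha>"] by (auto simp: Des_def negative_root_iff)
  qed
  have moves_proj: "moves \<A> (cell \<Phi> (w p)) (chamber_of \<Delta> id) (chamber_of \<Delta> w) \<longleftrightarrow> proj p" for p
  proof -
    have "moves \<A> (cell \<Phi> (w p)) (chamber_of \<Delta> id) (chamber_of \<Delta> w) \<longleftrightarrow>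
      (\<forall>\<beta>\<in>w ` \<Phi>. sgn (\<beta> \<bullet> w \<rho>) = (if \<beta> \<bullet> w p = 0 then sgn (\<beta> \<bullet> \<rho>) else sgn (\<beta> \<bullet> w p)))"
      unfolding chamber_of_cell[OF w] chamber_of_cell[OF id_in_group] image_roots[OF w]
      using moves_cells_iff[OF finite_roots regular_group_rho[OF id_in_group] regular_group_rho[OF w]]
      by simp
    then show ?thesis using w by (simp add: proj_def reflection_group_inner)
  qed
  have proj_face_point: "proj (face_point K)" if K: "K \<subseteq> \<Delta> - Des \<Phi> \<Delta> w" for K
  proof -
    have pos: "1 = (if \<beta> \<bullet> face_point K = 0 then sgn (w \<beta> \<bullet> \<rho>) else sgn (\<beta> \<bullet> face_point K))"
      if \<beta>: "\<beta> \<in> \<Phi>" "\<beta> \<bullet> \<rho> > 0" for \<beta>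
    proof (cases "\<beta> \<bullet> face_point K = 0")
      case True
      \<comment> \<open>\<beta> is a nonnegative combination of K, and w keeps the roots of K
        positive. Testing simple roots therefore suffices.\<close>
      have "\<beta> \<bullet> weight \<gamma> * (\<gamma> \<bullet> inverse_map w \<rho>) \<ge> 0" if \<gamma>: "\<gamma> \<in> \<Delta>" for \<gamma>
      proof (cases "\<gamma> \<in> K")
        case True
        then have "w \<gamma> \<bullet> \<rho> > 0" using K simp_pos by blast
        then show ?thesis
          using positive_root_weight[OF \<beta> \<gamma>] w by (simp add: reflection_group_inner_swap)
      next
        case False
        then show ?thesis using root_face_point_zero_iff[OF \<beta>(1), of K] True \<gamma> by simp
      qed
      then have "w \<beta> \<bullet> \<rho> \<ge> 0"
        unfolding reflection_group_inner_swap[OF w] by (subst inner_expansion) (rule sum_nonneg)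
      then show ?thesis
        using True root_inner_rho[OF group_root[OF w \<beta>(1)]] by (simp add: sgn_if)
    next
      case False
      then show ?thesis using dominant_positive_root[OF dominant_face_point \<beta>, of K] by simp
    qed
    show ?thesis
      unfolding proj_def
    proof
      fix \<beta> assume \<beta>: "\<beta> \<in> \<Phi>"
      show "sgn (\<beta> \<bullet> \<rho>) = (if \<beta> \<bullet> face_point K = 0 then sgn (w \<beta> \<bullet> \<rho>) else sgn (\<beta> \<bullet> face_point K))"
      proof (cases "\<beta> \<bullet> \<rho> > 0")
        case False
        then have "(- \<beta>) \<bullet> \<rho> > 0" using root_inner_rho[OF \<beta>] by simp
        from pos[OF uminus_root[OF \<beta>] this] this show ?thesis
          by (simp add: sgn_minus linear_neg[OF reflection_group_linear[OF w]] split: if_splits)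
      qed (use pos[OF \<beta>] in simp)
    qed
  qed
  show ?thesis
  proof
    assume m: "moves \<A> (cell \<Phi> p) (chamber_of \<Delta> id) (chamber_of \<Delta> w)"
    define q where "q = inverse_map w p"
    have p: "p = w q" by (simp add: q_def reflection_group_inv_right[OF w])
    have q: "proj q" using m moves_proj unfolding p by blast
    \<comment> \<open>The 1 is the sign of \<alpha> \<bullet> \<rho>. So q is dominant, and w sends
      the simple roots orthogonal to q to positive roots.\<close>
    have one: "1 = (if \<alpha> \<bullet> q = 0 then sgn (w \<alpha> \<bullet> \<rho>) else sgn (\<alpha> \<bullet> q))" if "\<alpha> \<in> \<Delta>" for \<alpha>
      using q that simple_subset simple_rho[OF that] unfolding proj_def by force
    have "dominant q"
      unfolding dominant_def using one by (metis less_eq_real_def sgn_1_pos)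
    let ?K = "{\<alpha>\<in>\<Delta>. \<alpha> \<bullet> q = 0}"
    have "\<alpha> \<notin> Des \<Phi> \<Delta> w" if "\<alpha> \<in> ?K" for \<alpha>
      using that one[of \<alpha>] simp_pos[of \<alpha>] by (auto simp: sgn_if split: if_splits)
    then have "?K \<subseteq> \<Delta> - Des \<Phi> \<Delta> w" by blast
    moreover have "cell \<Phi> p = w ` fundamental_face ?K"
      unfolding p image_cell[OF w, symmetric] cell_dominant_face_point[OF \<open>dominant q\<close>] ..
    ultimately show "\<exists>K \<subseteq> \<Delta> - Des \<Phi> \<Delta> w. cell \<Phi> p = w ` fundamental_face K" by blast
  next
    assume "\<exists>K \<subseteq> \<Delta> - Des \<Phi> \<Delta> w. cell \<Phi> p = w ` fundamental_face K"
    then obtain K where K: "K \<subseteq> \<Delta> - Des \<Phi> \<Delta> w" "cell \<Phi> p = cell \<Phi> (w (face_point K))"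
      unfolding image_cell[OF w] by blast
    show "moves \<A> (cell \<Phi> p) (chamber_of \<Delta> id) (chamber_of \<Delta> w)"
      unfolding K(2) moves_proj by (rule proj_face_point[OF K(1)])
  qed
qed

lemma transition_weight_chamber_of:
  assumes w: "w \<in> W"
  shows "transition_weight \<A> x (chamber_of \<Delta> id) (chamber_of \<Delta> w) =
    (\<Sum>K\<in>Pow (\<Delta> - Des \<Phi> \<Delta> w). face_weight \<A> x (w ` fundamental_face K))"
proof -
  have faces: "faces \<A> = range (cell \<Phi>)" by (rule faces_root_arrangement[OF zero_notin_roots])
  have "{F. F \<in> faces \<A> \<and> moves \<A> F (chamber_of \<Delta> id) (chamber_of \<Delta> w)} =
    (\<lambda>K. w ` fundamental_face K) ` Pow (\<Delta> - Des \<Phi> \<Delta> w)" (is "?L = ?R")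
  proof
    show "?L \<subseteq> ?R"
      using moves_chamber_iff[OF w] unfolding faces by blast
    show "?R \<subseteq> ?L"
    proof clarify
      fix K assume K: "K \<subseteq> \<Delta> - Des \<Phi> \<Delta> w"
      have "w ` fundamental_face K = cell \<Phi> (w (face_point K))" by (rule image_cell[OF w])
      then show "w ` fundamental_face K \<in> faces \<A> \<and>
          moves \<A> (w ` fundamental_face K) (chamber_of \<Delta> id) (chamber_of \<Delta> w)"
        using moves_chamber_iff[OF w, of "w (face_point K)"] K unfolding faces by auto
    qed
  qed
  moreover have "inj_on (\<lambda>K. w ` fundamental_face K) (Pow (\<Delta> - Des \<Phi> \<Delta> w))"
  proof (rule inj_onI)
    fix J K assume JK: "J \<in> Pow (\<Delta> - Des \<Phi> \<Delta> w)" "K \<in> Pow (\<Delta> - Des \<Phi> \<Delta> w)"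
      and "w ` fundamental_face J = w ` fundamental_face K"
    then have "fundamental_face J = fundamental_face K"
      using bij_is_inj[OF reflection_group_bij[OF w]] by (simp add: inj_image_eq_iff)
    then show "J = K" by (rule fundamental_face_eqD) (use JK in auto)
  qed
  ultimately show ?thesis
    unfolding transition_weight_def by (simp only: sum.reindex comp_def)
qed

section \<open>Counting the faces with a given support\<close>

lemma zero_notin_simple: "K \<subseteq> \<Delta> \<Longrightarrow> 0 \<notin> K"
  using simple_subset zero_notin_roots by blast

lemma fixed_space_parabolic: "K \<subseteq> \<Delta> \<Longrightarrow> fixed_space (carrier (reflection_group K)) = flat K"
  by (simp add: fixed_space_reflection_group zero_notin_simple flat_def)

lemma parabolic_subset: "K \<subseteq> \<Delta> \<Longrightarrow> carrier (reflection_group K) \<subseteq> W"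
  using simple_subset by (intro reflection_group_mono) auto

lemma parabolic_fixes:
  "K \<subseteq> \<Delta> \<Longrightarrow> w \<in> carrier (reflection_group K) \<Longrightarrow> v \<in> flat K \<Longrightarrow> w v = v"
  using fixed_space_parabolic[of K] unfolding fixed_space_def by blast

lemma fixes_face_point:
  assumes "K \<subseteq> \<Delta>" "w \<in> W" "dominant (w (face_point K))"
  shows "w (face_point K) = face_point K" "w \<in> carrier (reflection_group K)"
proof -
  have "{\<alpha>\<in>\<Delta>. \<alpha> \<bullet> face_point K = 0} = K" using assms(1) by (auto simp: inner_face_point split: if_splits)
  then show "w (face_point K) = face_point K" "w \<in> carrier (reflection_group K)"
    using dominant_unique[OF assms(2) dominant_face_point assms(3)] by auto
qed

text \<open>Fixing the flat fixes the dominant point \<open>face_point K\<close>, and the simple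
  roots orthogonal to that point are exactly those in K.\<close>

lemma parabolic_eq_fixator:
  assumes "K \<subseteq> \<Delta>"
  shows "carrier (reflection_group K) = {w\<in>W. \<forall>v\<in>flat K. w v = v}"
proof
  show "carrier (reflection_group K) \<subseteq> {w\<in>W. \<forall>v\<in>flat K. w v = v}"
    using parabolic_subset[OF assms] parabolic_fixes[OF assms] by blast
  show "{w\<in>W. \<forall>v\<in>flat K. w v = v} \<subseteq> carrier (reflection_group K)"
    using fixes_face_point(2)[OF assms] face_point_in_flat[OF assms] dominant_face_point by force
qed

text \<open>The image of the point of J has the signs of the point of K at all simple roots, so it
  is dominant and uniqueness of dominant vectors applies.\<close>

lemma stabilizer_fundamental_face:
  assumes "J \<subseteq> \<Delta>" "K \<subseteq> \<Delta>" "w \<in> W"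
  shows "w ` fundamental_face J = fundamental_face K \<longleftrightarrow> J = K \<and> w \<in> carrier (reflection_group K)"
proof
  assume eq: "w ` fundamental_face J = fundamental_face K"
  then have eq': "cell \<Phi> (w (face_point J)) = fundamental_face K" by (simp add: image_cell[OF assms(3)])
  have "dominant (w (face_point J))"
    unfolding dominant_def
  proof
    fix \<alpha> assume \<alpha>: "\<alpha> \<in> \<Delta>"
    then have "sgn (\<alpha> \<bullet> w (face_point J)) = sgn (\<alpha> \<bullet> face_point K)"
      using eq' simple_subset by (auto simp: cell_eq_iff)
    then show "0 \<le> \<alpha> \<bullet> w (face_point J)"
      using \<alpha> by (auto simp: inner_face_point sgn_if split: if_splits)
  qed
  note fix_J = fixes_face_point[OF assms(1,3) this]
  have "J = K" by (rule fundamental_face_eqD) (use eq' fix_J(1) assms in simp_all)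
  with fix_J(2) show "J = K \<and> w \<in> carrier (reflection_group K)" by simp
next
  assume JK: "J = K \<and> w \<in> carrier (reflection_group K)"
  then have "w (face_point K) = face_point K"
    using parabolic_fixes[OF assms(2) _ face_point_in_flat[OF assms(2)]] by blast
  then show "w ` fundamental_face J = fundamental_face K"
    using JK by (simp add: image_cell[OF assms(3)])
qed

lemma conjugate_parabolic_eq_fixator:
  assumes K: "K \<subseteq> \<Delta>" and g: "g \<in> W"
  shows "carrier (reflection_group (g ` K)) = {u\<in>W. \<forall>v\<in>g ` flat K. u v = v}"
proof -
  note gi = reflection_group_inv[OF g]
  have "u \<in> (\<lambda>u. g \<circ> u \<circ> inverse_map g) ` carrier (reflection_group K) \<longleftrightarrow>
    u \<in> W \<and> (\<forall>v\<in>flat K. u (g v) = g v)" for u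
  proof
    assume "u \<in> (\<lambda>u. g \<circ> u \<circ> inverse_map g) ` carrier (reflection_group K)"
    then obtain t where t: "u = g \<circ> t \<circ> inverse_map g" "t \<in> W" "\<forall>v\<in>flat K. t v = v"
      unfolding parabolic_eq_fixator[OF K] by blast
    then show "u \<in> W \<and> (\<forall>v\<in>flat K. u (g v) = g v)"
      using g gi by (auto simp: reflection_group_inv_left[OF g] intro!: reflection_group_comp)
  next
    assume u: "u \<in> W \<and> (\<forall>v\<in>flat K. u (g v) = g v)"
    let ?t = "inverse_map g \<circ> u \<circ> g"
    have "?t \<in> W" using u g gi by (intro reflection_group_comp) auto
    moreover have "\<forall>v\<in>flat K. ?t v = v" using u by (simp add: reflection_group_inv_left[OF g])
    ultimately have t: "?t \<in> carrier (reflection_group K)" by (simp add: parabolic_eq_fixator[OF K])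
    have "u = g \<circ> ?t \<circ> inverse_map g"
      by (simp add: fun_eq_iff reflection_group_inv_right[OF g])
    then show "u \<in> (\<lambda>u. g \<circ> u \<circ> inverse_map g) ` carrier (reflection_group K)" using t by (rule image_eqI)
  qed
  then show ?thesis
    unfolding conjugate_reflection_group[OF g] by auto
qed

text \<open>W_K and its flat determine each other, one as fixator and the other as fixed space, so g
  preserves both or neither.\<close>

lemma normalizer_parabolic:
  assumes K: "K \<subseteq> \<Delta>"
  shows "normalizer (reflection_group \<Phi>) (carrier (reflection_group K)) = {g\<in>W. g ` flat K = flat K}"
proof -
  have "(\<lambda>u. g \<circ> u \<circ> inverse_map g) ` carrier (reflection_group K) = carrier (reflection_group K)
    \<longleftrightarrow> g ` flat K = flat K" if g: "g \<in> W" for g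
    unfolding conjugate_reflection_group[OF g, symmetric]
  proof
    assume eq: "carrier (reflection_group (g ` K)) = carrier (reflection_group K)"
    have "0 \<notin> g ` K"
      using K simple_subset group_root[OF g] zero_notin_roots by (metis imageE subsetD)
    then have "flat (g ` K) = fixed_space (carrier (reflection_group (g ` K)))"
      by (simp add: fixed_space_reflection_group flat_def)
    then show "g ` flat K = flat K"
      by (simp add: eq fixed_space_parabolic[OF K] flat_image[OF g])
  next
    assume "g ` flat K = flat K"
    then show "carrier (reflection_group (g ` K)) = carrier (reflection_group K)"
      by (simp add: conjugate_parabolic_eq_fixator[OF K g] parabolic_eq_fixator[OF K])
  qed
  moreover have "K \<subseteq> \<Phi>" using K simple_subset by (rule subset_trans)
  ultimately show ?thesis unfolding reflection_group_normalizer[OF \<open>K \<subseteq> \<Phi>\<close>] by blast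
qed

section \<open>Conjugate flats come from conjugate sets of simple roots\<close>

text \<open>
  A simple root spans an extreme ray of the cone of positive roots, so it cannot be a nonnegative
  combination of other positive roots.
\<close>

lemma image_simple_subset:
  assumes g: "g \<in> W" and JK: "J \<subseteq> \<Delta>" "K \<subseteq> \<Delta>"
    and pos: "\<And>\<alpha>. \<alpha> \<in> K \<Longrightarrow> g \<alpha> \<bullet> \<rho> > 0"
    and span: "\<And>\<alpha>. \<alpha> \<in> K \<Longrightarrow> g \<alpha> \<bullet> face_point J = 0"
    and inv: "\<And>\<beta>. \<beta> \<in> J \<Longrightarrow> inverse_map g \<beta> \<bullet> \<rho> > 0"
  shows "g ` K \<subseteq> J"
proof clarify
  fix \<alpha> assume \<alpha>: "\<alpha> \<in> K"
  then have \<alpha>': "\<alpha> \<in> \<Delta>" "\<alpha> \<in> \<Phi>" using JK simple_subset by auto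
  have root: "g \<alpha> \<in> \<Phi>" using \<alpha>' group_root[OF g] by blast
  note coeff = positive_root_weight[OF root pos[OF \<alpha>]]
  have zero: "g \<alpha> \<bullet> weight \<gamma> = 0" if "\<gamma> \<in> \<Delta>" "\<gamma> \<notin> J" for \<gamma>
    using span[OF \<alpha>] root_face_point_zero_iff[OF root, of J] that by blast
  obtain \<beta> where \<beta>: "\<beta> \<in> \<Delta>" "g \<alpha> \<bullet> weight \<beta> \<noteq> 0"
    using pos[OF \<alpha>] unfolding inner_rho by (metis less_irrefl sum.neutral)
  then have \<beta>J: "\<beta> \<in> J" using zero by blast
  have \<beta>': "inverse_map g \<beta> \<in> \<Phi>"
    using \<beta> simple_subset group_root[OF reflection_group_inv[OF g]] by blast
  have "inverse_map g \<beta> \<bullet> weight \<gamma> = 0" if \<gamma>: "\<gamma> \<in> \<Delta> - {\<alpha>}" for \<gamma>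
  proof -
    have nonneg: "g \<alpha> \<bullet> weight \<delta> * (\<delta> \<bullet> g (weight \<gamma>)) \<ge> 0" if \<delta>: "\<delta> \<in> \<Delta>" for \<delta>
    proof (cases "\<delta> \<in> J")
      case True
      have "inverse_map g \<delta> \<in> \<Phi>"
        using \<delta> simple_subset group_root[OF reflection_group_inv[OF g]] by blast
      then have "inverse_map g \<delta> \<bullet> weight \<gamma> \<ge> 0"
        using positive_root_weight inv[OF True] \<gamma> by blast
      then show ?thesis using coeff[OF \<delta>] by (simp add: reflection_group_inner_swap'[OF g])
    qed (use zero \<delta> in simp)
    \<comment> \<open>Pulled back by g, this expands the coordinate of \<alpha> at \<gamma>, which
      is 0, into nonnegative terms. So every term vanishes, in particular the one of \<beta>, whose
      coefficient is nonzero.\<close>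
    have "(\<Sum>\<delta>\<in>\<Delta>. g \<alpha> \<bullet> weight \<delta> * (\<delta> \<bullet> g (weight \<gamma>))) = g \<alpha> \<bullet> g (weight \<gamma>)"
      by (rule inner_expansion[symmetric])
    also have "\<dots> = 0"
      using \<gamma> \<alpha>' by (auto simp: reflection_group_inner[OF g] inner_commute[of \<alpha>] weight_inner)
    finally have "(\<Sum>\<delta>\<in>\<Delta>. g \<alpha> \<bullet> weight \<delta> * (\<delta> \<bullet> g (weight \<gamma>))) = 0" .
    moreover have "g \<alpha> \<bullet> weight \<beta> * (\<beta> \<bullet> g (weight \<gamma>)) \<le>
        (\<Sum>\<delta>\<in>\<Delta>. g \<alpha> \<bullet> weight \<delta> * (\<delta> \<bullet> g (weight \<gamma>)))"
      by (rule member_le_sum[OF \<beta>(1) _ finite_simple]) (use nonneg in blast)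
    ultimately have "g \<alpha> \<bullet> weight \<beta> * (\<beta> \<bullet> g (weight \<gamma>)) = 0"
      using nonneg[OF \<beta>(1)] by linarith
    then show ?thesis using \<beta>(2) by (simp add: reflection_group_inner_swap'[OF g])
  qed
  then have "inverse_map g \<beta> = \<alpha>"
    using positive_root_in_span[OF \<beta>' inv[OF \<beta>J] \<alpha>'(1)] by blast
  then show "g \<alpha> \<in> J" using \<beta>J reflection_group_inv_right[OF g] by metis
qed

text \<open>The correction v \<in> W_K makes g \<rho> positive on K. Then g and its inverse both
  preserve positivity on J and K respectively, and \<open>image_simple_subset\<close> applies in
  both directions.\<close>

lemma conjugate_flats_conjugate_simple:
  assumes J: "J \<subseteq> \<Delta>" and K: "K \<subseteq> \<Delta>" and u: "u \<in> W" and flats: "u ` flat J = flat K"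
  shows "\<exists>g\<in>W. g ` J = K"
proof -
  obtain v where v: "v \<in> carrier (reflection_group K)" and dom: "\<forall>\<alpha>\<in>K. \<alpha> \<bullet> v (u \<rho>) \<ge> 0"
    using exists_dominant[OF K] by blast
  define g where "g = v \<circ> u"
  have vW: "v \<in> W" using v parabolic_subset[OF K] by blast
  then have g: "g \<in> W" using u by (simp only: g_def reflection_group_comp)
  note gi = reflection_group_inv[OF g]
  have "v ` flat K = flat K"
    using parabolic_fixes[OF K v] by simp
  then have g_flat: "g ` flat J = flat K" using flats by (simp add: g_def flip: image_image)
  have inv_pos: "inverse_map g \<alpha> \<bullet> \<rho> > 0" if \<alpha>: "\<alpha> \<in> K" for \<alpha>
  proof -
    have "\<alpha> \<bullet> g \<rho> \<ge> 0" using dom \<alpha> by (simp add: g_def)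
    moreover have "\<alpha> \<in> \<Phi>" using \<alpha> K simple_subset by blast
    then have "\<alpha> \<bullet> g \<rho> \<noteq> 0" using regular_group_rho[OF g] by (simp add: regular_def)
    ultimately show ?thesis by (simp add: reflection_group_inner_swap'[OF g])
  qed
  have inv_span: "inverse_map g \<alpha> \<bullet> face_point J = 0" if "\<alpha> \<in> K" for \<alpha>
  proof -
    have "g (face_point J) \<in> flat K" using g_flat face_point_in_flat[OF J] by blast
    then show ?thesis using that by (simp add: flat_def reflection_group_inner_swap'[OF g])
  qed
  have g_span: "g \<beta> \<bullet> face_point K = 0" if "\<beta> \<in> J" for \<beta>
  proof -
    have "face_point K \<in> g ` flat J" using g_flat face_point_in_flat[OF K] by blast
    then show ?thesis
      using that by (auto simp: flat_def mem_image_group[OF g] reflection_group_inner_swap[OF g])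
  qed
  have g_pos: "g \<beta> \<bullet> \<rho> > 0" if \<beta>: "\<beta> \<in> J" for \<beta>
  proof (rule ccontr)
    assume neg: "\<not> g \<beta> \<bullet> \<rho> > 0"
    have \<beta>': "\<beta> \<in> \<Delta>" "\<beta> \<in> \<Phi>" using \<beta> J simple_subset by auto
    have root: "g \<beta> \<in> \<Phi>" using group_root[OF g \<beta>'(2)] .
    \<comment> \<open>A negative g \<beta> would be a nonpositive combination of K, where g \<rho>
      is nonnegative. But its product with g \<rho> is \<beta> \<bullet> \<rho> = 1.\<close>
    have "g \<beta> \<bullet> weight \<gamma> * (\<gamma> \<bullet> g \<rho>) \<le> 0" if \<gamma>: "\<gamma> \<in> \<Delta>" for \<gamma>
    proof (cases "\<gamma> \<in> K")
      case True
      have "(- g \<beta>) \<bullet> \<rho> > 0" using neg root_inner_rho[OF root] by simp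
      from positive_root_weight[OF uminus_root[OF root] this \<gamma>] have "g \<beta> \<bullet> weight \<gamma> \<le> 0" by simp
      moreover have "\<gamma> \<bullet> g \<rho> \<ge> 0" using dom True by (simp add: g_def)
      ultimately show ?thesis by (rule mult_nonpos_nonneg)
    next
      case False
      then show ?thesis using g_span[OF \<beta>] root_face_point_zero_iff[OF root, of K] \<gamma> by simp
    qed
    then have "g \<beta> \<bullet> g \<rho> \<le> 0" by (subst inner_expansion) (rule sum_nonpos)
    then show False using simple_rho[OF \<beta>'(1)] by (simp add: reflection_group_inner[OF g])
  qed
  have "g ` J \<subseteq> K"
    by (rule image_simple_subset[OF g K J g_pos g_span inv_pos])
  moreover have "inverse_map g ` K \<subseteq> J"
    using g_pos by (intro image_simple_subset[OF gi J K inv_pos inv_span])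
      (simp_all add: inverse_map_inverse_map[OF g])
  then have "K \<subseteq> g ` J" by (auto simp: mem_image_group[OF g])
  ultimately show ?thesis using g by blast
qed

lemma conj_subsets_iff:
  assumes "K \<subseteq> \<Delta>" "J \<subseteq> \<Delta>"
  shows "J \<in> conj_subsets \<Phi> \<Delta> K \<longleftrightarrow> (\<exists>u\<in>W. u ` flat J = flat K)"
proof
  assume "J \<in> conj_subsets \<Phi> \<Delta> K"
  then obtain w where w: "w \<in> W" "w ` K = J" unfolding conj_subsets_def by blast
  have "inverse_map w ` flat J = flat K"
    using w bij_is_inj[OF reflection_group_bij[OF w(1)]] flat_image[OF w(1), of K]
    by (simp add: image_inv_f_f)
  then show "\<exists>u\<in>W. u ` flat J = flat K" using reflection_group_inv[OF w(1)] by blast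
next
  assume "\<exists>u\<in>W. u ` flat J = flat K"
  then obtain g where g: "g \<in> W" "g ` J = K"
    using conjugate_flats_conjugate_simple[OF assms(2,1)] by blast
  then have "inverse_map g ` K = J"
    using bij_is_inj[OF reflection_group_bij[OF g(1)]] by (auto simp: image_inv_f_f)
  then show "J \<in> conj_subsets \<Phi> \<Delta> K"
    using assms(2) reflection_group_inv[OF g(1)] by (auto simp: conj_subsets_def)
qed

section \<open>Transporters and the double count\<close>

lemma card_parabolic_conj_subsets:
  assumes "J \<in> conj_subsets \<Phi> \<Delta> K"
  shows "card (carrier (reflection_group J)) = card (carrier (reflection_group K))"
proof -
  obtain w where "w \<in> W" "w ` K = J" using assms unfolding conj_subsets_def by blast
  then show ?thesis using card_conjugate_reflection_group[of w \<Phi> K] by simp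
qed

text \<open>One transporter u yields all others by composing with the stabilizer of the target flat,
  which is the conjugate by w of the stabilizer of \<open>flat K\<close>.\<close>

lemma card_transporter:
  assumes w: "w \<in> W" and u: "u \<in> W" and eq: "u ` flat J = w ` flat K"
  shows "card {t\<in>W. t ` flat J = w ` flat K} = card {g\<in>W. g ` flat K = flat K}"
proof (rule sym, rule bij_betw_same_card, rule bij_betwI')
  let ?T = "{t\<in>W. t ` flat J = w ` flat K}" and ?N = "{g\<in>W. g ` flat K = flat K}"
  let ?f = "\<lambda>g. w \<circ> g \<circ> inverse_map w \<circ> u"
  note wi = reflection_group_inv[OF w] and ui = reflection_group_inv[OF u]
  note inv = reflection_group_inv_left[OF w] reflection_group_inv_right[OF w]
    reflection_group_inv_left[OF u] reflection_group_inv_right[OF u]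
  have invs: "inverse_map w ` w ` S = S" "inverse_map u ` u ` S = S" for S
    by (simp_all add: image_image inv)
  show "?f g = ?f h \<longleftrightarrow> g = h" for g h
  proof
    assume "?f g = ?f h"
    then have "inverse_map w (?f g (inverse_map u (w v))) = inverse_map w (?f h (inverse_map u (w v)))" for v
      by simp
    then show "g = h" by (simp add: inv fun_eq_iff)
  qed simp
  show "?f g \<in> ?T" if "g \<in> ?N" for g
  proof -
    have "?f g ` flat J = w ` g ` inverse_map w ` u ` flat J" by (simp add: image_image)
    also have "\<dots> = w ` flat K" using that by (simp add: eq invs)
    finally have "?f g ` flat J = w ` flat K" .
    moreover have "?f g \<in> W" using that w wi u by (intro reflection_group_comp) auto
    ultimately show ?thesis by simp
  qed
  show "\<exists>g\<in>?N. t = ?f g" if "t \<in> ?T" for t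
  proof
    let ?g = "inverse_map w \<circ> t \<circ> inverse_map u \<circ> w"
    show "t = ?f ?g" by (simp add: fun_eq_iff inv)
    have "?g ` flat K = inverse_map w ` t ` inverse_map u ` w ` flat K" by (simp add: image_image)
    also have "\<dots> = flat K" using that by (simp add: invs flip: eq) (simp add: eq invs)
    finally have "?g ` flat K = flat K" .
    moreover have "?g \<in> W" using that w wi ui by (intro reflection_group_comp) auto
    ultimately show "?g \<in> ?N" by simp
  qed
qed

lemma face_representative:
  assumes "F \<in> faces \<A>"
  shows "\<exists>u\<in>W. \<exists>J\<subseteq>\<Delta>. F = u ` fundamental_face J"
proof -
  obtain p where p: "F = cell \<Phi> p"
    using assms faces_root_arrangement[OF zero_notin_roots] by auto
  obtain w where w: "w \<in> W" "dominant (w p)"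
    using exists_dominant[of \<Delta> p] unfolding group_generated_by_simple dominant_def by blast
  have "F = inverse_map w ` cell \<Phi> (w p)"
    using image_cell[OF reflection_group_inv[OF w(1)], of "w p"] by (simp add: p reflection_group_inv_left[OF w(1)])
  then show ?thesis
    using reflection_group_inv[OF w(1)] cell_dominant_face_point[OF w(2)]
    by (intro bexI[of _ "inverse_map w"] exI[of _ "{\<alpha>\<in>\<Delta>. \<alpha> \<bullet> w p = 0}"]) auto
qed

text \<open>
  Both sides count the pairs \<open>(J, u)\<close> such that the face \<open>u F\<^sub>J\<close> has support \<open>w Fix(W\<^sub>K)\<close>:
  on the left by the face, on the right by \<open>J\<close>.
\<close>

lemma card_faces_with_support:
  assumes w: "w \<in> W" and K: "K \<subseteq> \<Delta>"
  shows "card {G\<in>faces \<A>. supp_flat \<A> G = w ` flat K} * card (carrier (reflection_group K)) =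
    card (conj_subsets \<Phi> \<Delta> K) * card (normalizer (reflection_group \<Phi>) (carrier (reflection_group K)))"
proof -
  define T where "T J = {t\<in>W. t ` flat J = w ` flat K}" for J
  define P where "P = Sigma (Pow \<Delta>) T"
  define \<pi> :: "'a set \<times> ('a \<Rightarrow> 'a) \<Rightarrow> 'a set" where "\<pi> = (\<lambda>(J, u). u ` fundamental_face J)"
  define S where "S = {G\<in>faces \<A>. supp_flat \<A> G = w ` flat K}"
  let ?N = "normalizer (reflection_group \<Phi>) (carrier (reflection_group K))"
  let ?conj = "conj_subsets \<Phi> \<Delta> K"
  have finT: "finite (T J)" for J using finite_group by (simp add: T_def)
  have finP: "finite P" using finT finite_simple by (simp add: P_def)
  have supp: "supp_flat \<A> (u ` fundamental_face J) = u ` flat J" if "u \<in> W" "J \<subseteq> \<Delta>" for u J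
    using that by (simp add: supp_flat_image supp_flat_fundamental_face)
  have T_iff: "T J \<noteq> {} \<longleftrightarrow> J \<in> ?conj" if J: "J \<subseteq> \<Delta>" for J
  proof
    assume "T J \<noteq> {}"
    then obtain t where t: "t \<in> W" "t ` flat J = w ` flat K" unfolding T_def by blast
    have "(inverse_map w \<circ> t) ` flat J = inverse_map w ` w ` flat K"
      by (simp only: image_comp[symmetric] t(2))
    also have "\<dots> = flat K" by (simp add: image_image reflection_group_inv_left[OF w])
    finally show "J \<in> ?conj"
      using conj_subsets_iff[OF K J] reflection_group_comp[OF reflection_group_inv[OF w] t(1)] by blast
  next
    assume "J \<in> ?conj"
    then obtain u where u: "u \<in> W" "u ` flat J = flat K" using conj_subsets_iff[OF K J] by blast
    then have "w \<circ> u \<in> T J"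
      using reflection_group_comp[OF w u(1)] unfolding T_def by (simp add: image_comp[symmetric] del: o_apply)
    then show "T J \<noteq> {}" by blast
  qed
  have \<lambda>: "?conj \<subseteq> Pow \<Delta>" by (auto simp: conj_subsets_def)
  have cardT: "card (T J) = (if J \<in> ?conj then card ?N else 0)" if J: "J \<subseteq> \<Delta>" for J
  proof (cases "J \<in> ?conj")
    case True
    then obtain t where "t \<in> W" "t ` flat J = w ` flat K" using T_iff[OF J] unfolding T_def by blast
    then show ?thesis
      using True card_transporter[OF w] by (simp add: T_def normalizer_parabolic[OF K])
  next
    case False
    then show ?thesis using T_iff[OF J] by simp
  qed
  have "card P = (\<Sum>J\<in>Pow \<Delta>. card (T J))"
    unfolding P_def using finite_simple finT by (intro card_SigmaI) auto
  also have "\<dots> = (\<Sum>J\<in>Pow \<Delta>. if J \<in> ?conj then card ?N else 0)"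
    using cardT by (intro sum.cong) auto
  also have "\<dots> = card ?conj * card ?N"
    using finite_simple \<lambda> by (simp add: sum.If_cases Int_absorb1)
  finally have 1: "card P = card ?conj * card ?N" .
  have image: "\<pi> ` P = S"
  proof
    show "\<pi> ` P \<subseteq> S"
    proof clarify
      fix J u assume "(J, u) \<in> P"
      then have Ju: "J \<subseteq> \<Delta>" "u \<in> W" "u ` flat J = w ` flat K" by (auto simp: P_def T_def)
      have "u ` fundamental_face J \<in> faces \<A>"
        by (simp add: image_cell[OF Ju(2)] faces_root_arrangement[OF zero_notin_roots])
      then show "\<pi> (J, u) \<in> S" using Ju supp by (simp add: \<pi>_def S_def)
    qed
    show "S \<subseteq> \<pi> ` P"
    proof
      fix F assume F: "F \<in> S"
      then have "F \<in> faces \<A>" by (simp add: S_def)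
      then obtain u J where uJ: "u \<in> W" "J \<subseteq> \<Delta>" "F = u ` fundamental_face J"
        using face_representative by blast
      then have "u ` flat J = w ` flat K" using F supp by (simp add: S_def)
      then have "(J, u) \<in> P" using uJ by (simp add: P_def T_def)
      then show "F \<in> \<pi> ` P" using uJ(3) by (auto simp: \<pi>_def intro!: image_eqI[of _ _ "(J, u)"])
    qed
  qed
  have fibre: "card {p\<in>P. \<pi> p = F} = card (carrier (reflection_group K))" if "F \<in> S" for F
  proof -
    have "F \<in> \<pi> ` P" using that by (simp only: image)
    then obtain p where "F = \<pi> p" "p \<in> P" by (rule imageE)
    then obtain J u where Ju: "(J, u) \<in> P" and F: "F = u ` fundamental_face J"
      unfolding \<pi>_def by (cases p) auto
    then have J: "J \<subseteq> \<Delta>" and u: "u \<in> W" and u_flat: "u ` flat J = w ` flat K" by (auto simp: P_def T_def)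
    note ui = reflection_group_inv[OF u]
    \<comment> \<open>The type J is determined by the face, and the elements carrying the
      fundamental face of J to F form the coset u W_J.\<close>
    have "{p\<in>P. \<pi> p = F} = (\<lambda>v. (J, u \<circ> v)) ` carrier (reflection_group J)"
    proof
      show "{p\<in>P. \<pi> p = F} \<subseteq> (\<lambda>v. (J, u \<circ> v)) ` carrier (reflection_group J)"
      proof
        fix z assume "z \<in> {p\<in>P. \<pi> p = F}"
        then obtain J' t where z: "z = (J', t)" and "(J', t) \<in> P" and F': "\<pi> (J', t) = F"
          by (cases z) auto
        then have t: "J' \<subseteq> \<Delta>" "t \<in> W" by (auto simp: P_def T_def)
        have "(inverse_map u \<circ> t) ` fundamental_face J' = inverse_map u ` u ` fundamental_face J"
          using F' by (simp only: image_comp[symmetric] \<pi>_def F prod.case)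
        also have "\<dots> = fundamental_face J" by (simp add: image_image reflection_group_inv_left[OF u])
        finally have "J' = J" "inverse_map u \<circ> t \<in> carrier (reflection_group J)"
          using stabilizer_fundamental_face[OF t(1) J reflection_group_comp[OF ui t(2)]] by blast+
        moreover have "t = u \<circ> (inverse_map u \<circ> t)" by (simp add: fun_eq_iff reflection_group_inv_right[OF u])
        ultimately show "z \<in> (\<lambda>v. (J, u \<circ> v)) ` carrier (reflection_group J)" unfolding z by blast
      qed
      show "(\<lambda>v. (J, u \<circ> v)) ` carrier (reflection_group J) \<subseteq> {p\<in>P. \<pi> p = F}"
      proof clarify
        fix v assume v: "v \<in> carrier (reflection_group J)"
        then have vW: "v \<in> W" using parabolic_subset[OF J] by blast
        have "v ` flat J = flat J" using parabolic_fixes[OF J v] by simp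
        then have "(u \<circ> v) ` flat J = w ` flat K" by (simp only: image_comp[symmetric] u_flat)
        moreover have "v ` fundamental_face J = fundamental_face J"
          using stabilizer_fundamental_face[OF J J vW] v by blast
        then have "(u \<circ> v) ` fundamental_face J = F" by (simp only: image_comp[symmetric] F)
        ultimately show "(J, u \<circ> v) \<in> P \<and> \<pi> (J, u \<circ> v) = F"
          using J reflection_group_comp[OF u vW] by (simp add: P_def T_def \<pi>_def)
      qed
    qed
    moreover have "inj_on (\<lambda>v. (J, u \<circ> v)) (carrier (reflection_group J))"
    proof (rule inj_onI)
      fix a b assume "(J, u \<circ> a) = (J, u \<circ> b)"
      then have "u (a y) = u (b y)" for y by (metis comp_apply prod.inject)
      then show "a = b" using reflection_group_inv_left[OF u] by (metis ext)
    qed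
    ultimately have "card {p\<in>P. \<pi> p = F} = card (carrier (reflection_group J))" by (simp add: card_image)
    \<comment> \<open>Conjugate parabolic subgroups have equal order, so the fibre size does not
      depend on the type J of the face.\<close>
    moreover have "J \<in> ?conj" using T_iff[OF J] u u_flat unfolding T_def by blast
    ultimately show ?thesis using card_parabolic_conj_subsets by simp
  qed
  have "finite S" unfolding image[symmetric] by (rule finite_imageI[OF finP])
  have "card P = (\<Sum>p\<in>P. 1)" by simp
  also have "\<dots> = (\<Sum>F\<in>S. \<Sum>p | p \<in> P \<and> \<pi> p = F. 1)"
    by (rule sum.group[symmetric, OF finP \<open>finite S\<close> equalityD1[OF image]])
  also have "\<dots> = (\<Sum>F\<in>S. card {p\<in>P. \<pi> p = F})" by simp
  also have "\<dots> = card S * card (carrier (reflection_group K))" using fibre by simp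
  finally show ?thesis using 1 by (simp add: S_def)
qed

section \<open>From the face count to the weights in \<open>coxeter_H\<close>\<close>

lemma dim_space: "dim (UNIV :: 'a set) = card \<Delta>"
  by (rule dim_unique[of \<Delta>]) (simp_all add: span_simple independent_simple)

lemma face_weight_fundamental_face:
  assumes w: "w \<in> W" and K: "K \<subseteq> \<Delta>"
  shows "face_weight \<A> x (w ` fundamental_face K) =
    (real (card (carrier (reflection_group K))) * flat_char_poly \<A> (flat K) x) /
    (x ^ card \<Delta> * real (card (normalizer (reflection_group \<Phi>) (carrier (reflection_group K)))) *
      real (card (conj_subsets \<Phi> \<Delta> K)))"
proof -
  let ?S = "{G\<in>faces \<A>. supp_flat \<A> G = w ` flat K}"
  let ?c = "real (card (carrier (reflection_group K)))"
  have supp: "supp_flat \<A> (w ` fundamental_face K) = w ` flat K"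
    by (simp add: supp_flat_image[OF w] supp_flat_fundamental_face[OF K])
  have char: "flat_char_poly \<A> (w ` flat K) x = flat_char_poly \<A> (flat K) x"
    by (rule flat_char_poly_image[OF reflection_group_linear[OF w] reflection_group_bij[OF w] image_arrangement[OF w]])
  have "finite (carrier (reflection_group K))"
    using finite_subset[OF parabolic_subset[OF K] finite_group] .
  then have c: "?c \<noteq> 0" using reflection_group_id[of K] by auto
  have count: "real (card ?S) * ?c = real (card (conj_subsets \<Phi> \<Delta> K)) *
      real (card (normalizer (reflection_group \<Phi>) (carrier (reflection_group K))))"
    using arg_cong[OF card_faces_with_support[OF w K], of real] by (simp only: of_nat_mult)
  have "face_weight \<A> x (w ` fundamental_face K) =
      flat_char_poly \<A> (flat K) x / (x ^ card \<Delta> * real (card ?S))"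
    by (simp add: face_weight_def supp char dim_space)
  \<comment> \<open>The count concerns the number of faces times |W_K|. Extending the fraction by
    |W_K|, which is nonzero, brings this product into the denominator.\<close>
  also have "\<dots> = (?c * flat_char_poly \<A> (flat K) x) / (?c * (x ^ card \<Delta> * real (card ?S)))"
    using c by simp
  also have "?c * (x ^ card \<Delta> * real (card ?S)) = x ^ card \<Delta> * (real (card ?S) * ?c)"
    by simp
  finally show ?thesis unfolding count by (simp add: mult_ac)
qed

lemma transition_weight_eq_coxeter_H:
  assumes w: "w \<in> W"
  shows "transition_weight \<A> x (chamber_of \<Delta> id) (chamber_of \<Delta> w) = coxeter_H \<Phi> \<Delta> x w"
  unfolding transition_weight_chamber_of[OF w] coxeter_H_def Let_def
proof (rule sum.cong[OF refl])
  fix K assume "K \<in> Pow (\<Delta> - Des \<Phi> \<Delta> w)"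
  then have K: "K \<subseteq> \<Delta>" by blast
  show "face_weight \<A> x (w ` fundamental_face K) =
    (real (card (carrier (reflection_group K))) *
      flat_char_poly \<A> (fixed_space (carrier (reflection_group K))) x) /
    (x ^ card \<Delta> * real (card (normalizer (reflection_group \<Phi>) (carrier (reflection_group K)))) *
      real (card (conj_subsets \<Phi> \<Delta> K)))"
    unfolding fixed_space_parabolic[OF K] by (rule face_weight_fundamental_face[OF w K])
qed

end

theorem theorem1:
  fixes \<Phi> \<Delta> :: "'a::real_inner set" and x :: real and w :: "'a \<Rightarrow> 'a"
  assumes "root_system \<Phi>"
    and "simple_system \<Phi> \<Delta>"
    and "x \<noteq> 0"
    and "w \<in> carrier (reflection_group \<Phi>)"
  shows "transition_weight (root_arrangement \<Phi>) x (chamber_of \<Delta> id) (chamber_of \<Delta> w) =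
         coxeter_H \<Phi> \<Delta> x w"
proof -
  interpret simple_roots \<Phi> \<Delta>
    using assms by unfold_locales
  show ?thesis
    by (rule transition_weight_eq_coxeter_H[OF assms(4)])
qed

end
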